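(* Let $q$ be a real-valued, $1$-periodic function with $q\in L_1[0,1]$ and $\int_0^1 q(x)\,dx=0$. Let $\lambda_{n,1}\le\lambda_{n,2}$ and $\alpha_{n,j}$ be as defined in the context. If, for all sufficiently large $n$, $$|q_{2n}|\ge2(|\alpha_{n,1}|+|\alpha_{n,2}|),$$ then there is $N$ such that the eigenvalues $\lambda_{n,j}$ for $j=1,2$ and $n\ge N$ are simple, and they satisfy $$\lambda_{n,j}=(2\pi n)^2+(-1)^j|q_{2n}|+o\left(\frac1n\right)$$ as $n\to\infty$.
   Context: $L_0(q)$ is the operator in $L_2[0,1]$ generated by $-y''+qy$ with periodic boundary conditions $y(1)=y(0)$, $y'(1)=y'(0)$. Its large eigenvalues, counted with multiplicity, form two sequences $\lambda_{n,1}\le\lambda_{n,2}$ ($n\ge N_0$, $N_0$ a sufficiently large integer) with $\lambda_{n,j}=(2\pi n)^2+O(n^{1/2})$. $(\cdot,\cdot)$ is the inner product of $L_2[0,1]$ and $q_k=(q,e^{i2\pi kx})=\int_0^1q(x)e^{-i2\pi kx}dx$. $\Psi_{n,j}$ is a real-valued eigenfunction of $L_0(q)$ for $\lambda_{n,j}$ with $L_2[0,1]$-norm $1$; if $\lambda_{n,1}=\lambda_{n,2}$, then $\Psi_{n,1}$ and $\Psi_{n,2}$ are chosen orthogonal. Put $u_{n,j}=(\Psi_{n,j},e^{i2\pi nx})$ and define $\alpha_{n,j}$ by $$(\lambda_{n,j}-(2\pi n)^2)u_{n,j}=q_{2n}\overline{u_{n,j}}+\alpha_{n,j}.$$ (One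 has $\alpha_{n,j}=o(n^{-1})$.)
   Formalization: Simplicity of λ_{n,j} is claimed only for those n≥N with q_{2n}≠0; as printed the claim fails for q=0, where the inequality reads 0≥0 and λ_{n,1}=λ_{n,2}=(2πn)² is double. The asymptotic formula is proved for all n as stated. *)

theory Defs
  imports
    "HOL-Analysis.Analysis"
    "HOL-Library.Landau_Symbols"
    "HOL-Library.Function_Algebras"
begin

definition ip01 :: "(real \<Rightarrow> complex) \<Rightarrow> (real \<Rightarrow> complex) \<Rightarrow> complex" where
  "ip01 f g = (LINT x:{0..1}|lebesgue. f x * cnj (g x))"

definition norm01 :: "(real \<Rightarrow> complex) \<Rightarrow> real" where
  "norm01 f = sqrt (LINT x:{0..1}|lebesgue. (cmod (f x))\<^sup>2)"

definition L2_01 :: "(real \<Rightarrow> complex) set" where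
  "L2_01 = {f. set_borel_measurable lebesgue {0..1} f \<and>
               (\<lambda>x. (cmod (f x))\<^sup>2) absolutely_integrable_on {0..1}}"

definition expi2pi :: "int \<Rightarrow> real \<Rightarrow> complex" where
  "expi2pi k x = exp (\<i> * 2 * of_real pi * of_int k * of_real x)"

definition fourier01 :: "(real \<Rightarrow> complex) \<Rightarrow> int \<Rightarrow> complex" where
  "fourier01 f k = ip01 f (expi2pi k)"

text \<open>
  The graph of the operator generated in \<open>L\<^sub>2[0,1]\<close> by \<open>-y'' + q y\<close> and periodic boundary
  conditions: \<open>y\<close> is in the domain and is mapped to \<open>f\<close>.  The function \<open>y\<close> is differentiable
  and \<open>y'\<close> is absolutely continuous, expressed as being the indefinite integral of a
  Lebesgue integrable function \<open>y''\<close>.  Values of \<open>y\<close> and \<open>f\<close> outside \<open>[0,1]\<close> are irrelevant.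
\<close>

definition L0_maps :: "(real \<Rightarrow> real) \<Rightarrow> (real \<Rightarrow> complex) \<Rightarrow> (real \<Rightarrow> complex) \<Rightarrow> bool" where
  "L0_maps q y f \<longleftrightarrow> f \<in> L2_01 \<and>
     (\<exists>y' y''.
        (\<forall>x\<in>{0..1}. (y has_vector_derivative y' x) (at x within {0..1})) \<and>
        y'' absolutely_integrable_on {0..1} \<and>
        (\<forall>x\<in>{0..1}. y' x = y' 0 + (LINT t:{0..x}|lebesgue. y'' t)) \<and>
        y 1 = y 0 \<and> y' 1 = y' 0 \<and>
        (AE x in lebesgue. x \<in> {0..1} \<longrightarrow> f x = - y'' x + of_real (q x) * y x))"

definition L0_eigenfunction :: "(real \<Rightarrow> real) \<Rightarrow> complex \<Rightarrow> (real \<Rightarrow> complex) \<Rightarrow> bool" where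
  "L0_eigenfunction q \<mu> y \<longleftrightarrow> L0_maps q y (\<lambda>x. \<mu> * y x) \<and> (\<exists>x\<in>{0..1}. y x \<noteq> 0)"

text \<open>
  To have a space of functions on \<open>[0,1]\<close>, elements of the eigenspace are normalised to vanish
  outside \<open>[0,1]\<close>.  For real \<open>q\<close> the operator is self-adjoint, so the multiplicity of an
  eigenvalue is the dimension of its eigenspace over the complex numbers.
\<close>

definition L0_eigenspace :: "(real \<Rightarrow> real) \<Rightarrow> complex \<Rightarrow> (real \<Rightarrow> complex) set" where
  "L0_eigenspace q \<mu> = {y. L0_maps q y (\<lambda>x. \<mu> * y x) \<and> (\<forall>x. x \<notin> {0..1} \<longrightarrow> y x = 0)}"

definition fun_scale :: "complex \<Rightarrow> (real \<Rightarrow> complex) \<Rightarrow> real \<Rightarrow> complex" where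
  "fun_scale c f = (\<lambda>x. c * f x)"

lemma vector_space_fun_scale: "vector_space fun_scale"
  by unfold_locales (auto simp: fun_scale_def fun_eq_iff algebra_simps)

definition L0_mult :: "(real \<Rightarrow> real) \<Rightarrow> complex \<Rightarrow> nat" where
  "L0_mult q \<mu> = vector_space.dim fun_scale (L0_eigenspace q \<mu>)"

definition L0_simple_eigenvalue :: "(real \<Rightarrow> real) \<Rightarrow> complex \<Rightarrow> bool" where
  "L0_simple_eigenvalue q \<mu> \<longleftrightarrow> L0_mult q \<mu> = 1"

text \<open>
  The eigenvalues above some bound \<open>R\<close>, counted with multiplicity, are exactly the numbers
  \<open>lam n j\<close> with \<open>n \<ge> N0\<close> and \<open>j \<in> {1, 2}\<close>.  Values of \<open>lam\<close> at other indices are irrelevant.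
\<close>

definition L0_eigenvalue_sequences ::
    "(real \<Rightarrow> real) \<Rightarrow> nat \<Rightarrow> (nat \<Rightarrow> nat \<Rightarrow> real) \<Rightarrow> bool" where
  "L0_eigenvalue_sequences q N0 lam \<longleftrightarrow>
     (\<exists>R. (\<forall>n\<ge>N0. \<forall>j\<in>{1,2}. lam n j > R) \<and>
          (\<forall>\<mu>>R. finite {(n, j). n \<ge> N0 \<and> j \<in> {1,2} \<and> lam n j = \<mu>} \<and>
             card {(n, j). n \<ge> N0 \<and> j \<in> {1,2} \<and> lam n j = \<mu>} = L0_mult q (of_real \<mu>))) \<and>
     (\<forall>n\<ge>N0. lam n 1 \<le> lam n 2) \<and>
     (\<forall>j\<in>{1,2}. (\<lambda>n. lam n j - (2 * pi * real n)\<^sup>2) \<in> O(\<lambda>n. real n powr (1/2)))"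

definition L0_normalized_eigenfunctions ::
    "(real \<Rightarrow> real) \<Rightarrow> nat \<Rightarrow> (nat \<Rightarrow> nat \<Rightarrow> real) \<Rightarrow> (nat \<Rightarrow> nat \<Rightarrow> real \<Rightarrow> real) \<Rightarrow> bool" where
  "L0_normalized_eigenfunctions q N0 lam \<Psi> \<longleftrightarrow>
     (\<forall>n\<ge>N0. (\<forall>j\<in>{1,2}.
          L0_eigenfunction q (of_real (lam n j)) (\<lambda>x. of_real (\<Psi> n j x)) \<and>
          norm01 (\<lambda>x. of_real (\<Psi> n j x)) = 1) \<and>
        (lam n 1 = lam n 2 \<longrightarrow>
          ip01 (\<lambda>x. of_real (\<Psi> n 1 x)) (\<lambda>x. of_real (\<Psi> n 2 x)) = 0))"

definition alpha_rem ::
    "(real \<Rightarrow> real) \<Rightarrow> (nat \<Rightarrow> nat \<Rightarrow> real) \<Rightarrow> (nat \<Rightarrow> nat \<Rightarrow> real \<Rightarrow> real) \<Rightarrow> nat \<Rightarrow> nat \<Rightarrow> complex" where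
  "alpha_rem q lam \<Psi> n j =
     (let u = ip01 (\<lambda>x. of_real (\<Psi> n j x)) (expi2pi (int n))
      in of_real (lam n j - (2 * pi * real n)\<^sup>2) * u
         - fourier01 (\<lambda>x. of_real (q x)) (2 * int n) * cnj u)"

text \<open>
  A non-strict bound of the form \<open>|q\<^bsub>2n\<^esub>| \<ge> 2 (|\<alpha>\<^bsub>n,1\<^esub>| + |\<alpha>\<^bsub>n,2\<^esub>|)\<close> does not by itself give
  simple eigenvalues: when \<open>q\<^bsub>2n\<^esub> = 0\<close> it forces \<open>\<alpha>\<^bsub>n,1\<^esub> = \<alpha>\<^bsub>n,2\<^esub> = 0\<close>, so (for large \<open>n\<close>, where
  the coefficients \<open>u\<^bsub>n,j\<^esub>\<close> do not vanish) both eigenvalues equal \<open>(2\<pi>n)\<^sup>2\<close>.  The case \<open>q = 0\<close> is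
  an example.  Hence simplicity can only be claimed for those \<open>n\<close> with \<open>q\<^bsub>2n\<^esub> \<noteq> 0\<close>.
\<close>

end

theory Submission imports Defs begin

text \<open>
  Write \<open>w = 2\<pi>n\<close>, \<open>\<delta> = \<lambda> - w\<^sup>2\<close> and \<open>\<kappa> = q\<^bsub>2n\<^esub>\<close>.  The defining relation of \<open>\<alpha>\<close> reads
  \<open>\<delta> u = \<kappa> cnj u + \<alpha>\<close>, so taking absolute values gives \<open>\<bar>\<delta>\<bar> = \<bar>\<kappa>\<bar>\<close> up to a multiple of \<open>\<bar>\<alpha>\<bar>\<close>,
  because \<open>\<bar>u\<bar>\<^sup>2\<close> tends to \<open>1/2\<close>.  The theorem then needs two things: the bound \<open>\<alpha> = o(1/n)\<close>, and an argument
  that the two eigenvalues of index \<open>n\<close> receive opposite signs.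

  For the bound (\<open>remainder_le\<close>, \<open>remainder_smallo\<close>) no Fourier series is summed.  A real eigenfunction
  \<open>y\<close> is encoded by the complex function \<open>p = exp (-iwx) (y' + iwy)\<close>, which satisfies
  \<open>p' = (q - \<delta>) y exp (-iwx)\<close> almost everywhere (\<open>p_eq\<close>), and \<open>y\<close> is recovered as \<open>Im (p exp (iwx)) / w\<close>.
  From \<open>\<delta> = O(n\<^sup>1\<^sup>/\<^sup>2)\<close> it follows that \<open>p\<close> moves by \<open>O(n\<^sup>1\<^sup>/\<^sup>2)\<close> only, so \<open>y\<close> is close to the wave
  \<open>c exp (iwx) + cnj c exp (-iwx)\<close>; this already gives \<open>\<bar>u\<bar>\<^sup>2 \<longlonglongrightarrow> 1/2\<close> and \<open>\<delta> = O(1)\<close>, which in turn improves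
  the distance of \<open>y\<close> from the wave to order \<open>1/n\<close>.  Inserting the wave into the equation of \<open>p\<close> identifies the next term: with \<open>Q\<close> the primitive of \<open>q\<close>, \<open>p = p(0) + c Q + o(1)\<close> uniformly, where the error
  is controlled by a Riemann-Lebesgue lemma that is uniform in the upper limit of integration
  (\<open>Riemann_Lebesgue_uniform\<close>).  Integrating \<open>q y exp (-iwx)\<close> over the period
  then gives \<open>\<alpha>\<close>, up to \<open>o(1/n)\<close>, as \<open>1/n\<close> times a bounded combination of \<open>\<integral> q Q = Q(1)\<^sup>2 / 2 = 0\<close> and the
  Fourier coefficient of index \<open>2n\<close> of \<open>q Q\<close>, which tends to zero.

  For the signs, \<open>\<Psi>\<^bsub>n,1\<^esub>\<close> and \<open>\<Psi>\<^bsub>n,2\<^esub>\<close> are orthogonal, by symmetry of the operator if the eigenvalues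
  differ and by choice if they agree, so \<open>Re (u\<^sub>1 cnj u\<^sub>2)\<close> tends to zero
  (\<open>orthogonal_pair_coefficients\<close>).  Together with \<open>\<bar>u\<^sub>j\<bar>\<^sup>2 \<longlonglongrightarrow> 1/2\<close> this forces \<open>u\<^sub>1\<^sup>2 + u\<^sub>2\<^sup>2 \<longlonglongrightarrow> 0\<close>.
  Multiplying the two relations by \<open>cnj u\<^sub>j\<close> and adding, the terms with \<open>\<kappa>\<close> nearly cancel, hence
  \<open>\<delta>\<^sub>1 \<bar>u\<^sub>1\<bar>\<^sup>2 + \<delta>\<^sub>2 \<bar>u\<^sub>2\<bar>\<^sup>2\<close> is at most \<open>o(\<bar>\<kappa>\<bar>) + \<bar>\<alpha>\<^sub>1\<bar> + \<bar>\<alpha>\<^sub>2\<bar>\<close> in size.  If both \<open>\<delta>\<^sub>j\<close> had the same sign, then \<open>\<bar>\<kappa>\<bar>\<close> itself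
  would be a multiple of \<open>\<bar>\<alpha>\<^sub>1\<bar> + \<bar>\<alpha>\<^sub>2\<bar>\<close> and the asymptotic formula would hold trivially
  (\<open>splitting_estimates\<close>).  Under \<open>\<bar>\<kappa>\<bar> \<ge> 2 (\<bar>\<alpha>\<^sub>1\<bar> + \<bar>\<alpha>\<^sub>2\<bar>)\<close> and \<open>\<kappa> \<noteq> 0\<close> the case \<open>\<delta>\<^sub>1 = \<delta>\<^sub>2\<close> is impossible
  (\<open>splitting_strict\<close>): it would give \<open>\<bar>\<kappa>\<bar> \<le> (\<surd>2 + o(1)) (\<bar>\<alpha>\<^sub>1\<bar> + \<bar>\<alpha>\<^sub>2\<bar>) + o(\<bar>\<kappa>\<bar>)\<close>.  Eigenvalues of different
  index \<open>n\<close> do not meet for large \<open>n\<close>, so every multiplicity is one.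
\<close>

section \<open>Integration by parts for absolutely continuous functions\<close>

lemma norm_integral_increment_le:
  fixes f :: "real \<Rightarrow> 'a::euclidean_space"
  assumes "f absolutely_integrable_on {0..1}" "0 \<le> a" "a \<le> b" "b \<le> 1"
  shows "norm (integral {0..b} f - integral {0..a} f)
    \<le> integral {0..b} (\<lambda>t. norm (f t)) - integral {0..a} (\<lambda>t. norm (f t))"
proof -
  have "f integrable_on {0..1}" "(\<lambda>t. norm (f t)) integrable_on {0..1}"
    using assms by (auto simp: absolutely_integrable_on_def)
  then have i: "f integrable_on {0..b}" "(\<lambda>t. norm (f t)) integrable_on {0..b}"
    using assms(3,4) by (auto elim!: integrable_subinterval_real)
  have "integral {0..a} f + integral {a..b} f = integral {0..b} f"
    using Henstock_Kurzweil_Integration.integral_combine[OF assms(2,3) i(1)] .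
  moreover have "integral {0..a} (\<lambda>t. norm (f t)) + integral {a..b} (\<lambda>t. norm (f t))
      = integral {0..b} (\<lambda>t. norm (f t))"
    using Henstock_Kurzweil_Integration.integral_combine[OF assms(2,3) i(2)] .
  moreover have "norm (integral {a..b} f) \<le> integral {a..b} (\<lambda>t. norm (f t))"
    using i assms by (intro integral_norm_bound_integral) (auto intro: integrable_subinterval_real)
  ultimately show ?thesis by (metis add_diff_cancel_left')
qed

text \<open>Cutting \<open>[0, x]\<close> into \<open>N\<close> pieces on which the continuous function \<open>V\<close> grows by equal amounts bounds the total
  increment of \<open>D\<close> by \<open>N\<close> terms of order \<open>1 / N\<^sup>2\<close>.  This replaces differentiation almost everywhere: for
  absolutely continuous functions, \<open>V\<close> is the integral of the absolute value of the derivative.\<close>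

lemma constant_if_increment_le_square:
  fixes D :: "real \<Rightarrow> 'a::real_normed_vector" and V :: "real \<Rightarrow> real"
  assumes V: "continuous_on {0..1} V"
    and D: "\<And>a b. 0 \<le> a \<Longrightarrow> a \<le> b \<Longrightarrow> b \<le> 1 \<Longrightarrow> norm (D b - D a) \<le> C * (V b - V a)\<^sup>2"
    and x: "x \<in> {0..1}" and mono: "V 0 \<le> V x"
  shows "D x = D 0"
proof -
  have D': "norm (D b - D a) \<le> C * (V b - V a)\<^sup>2" if "a \<in> {0..1}" "b \<in> {0..1}" for a b
    using D[of a b] D[of b a] that by (cases "a \<le> b") (auto simp: norm_minus_commute power2_commute)
  define L where "L = V x - V 0"
  have bound: "norm (D x - D 0) \<le> C * L\<^sup>2 / real N" if "N > 0" for N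
  proof -
    have "\<exists>t. 0 \<le> t \<and> t \<le> x \<and> V t = V 0 + real i / real N * L" if "i \<le> N" for i
    proof (rule IVT')
      have "0 \<le> real i / real N" "real i / real N \<le> 1" "0 \<le> L"
        using that \<open>N > 0\<close> mono by (auto simp: L_def divide_simps)
      then have "real i / real N * L \<le> 1 * L" "0 \<le> real i / real N * L"
        by (metis mult_right_mono, metis mult_nonneg_nonneg)
      then show "V 0 + real i / real N * L \<le> V x" "V 0 \<le> V 0 + real i / real N * L"
        by (auto simp: L_def)
    qed (use x in \<open>auto intro: continuous_on_subset[OF V]\<close>)
    then obtain s where s: "\<And>i. i \<le> N \<Longrightarrow> 0 \<le> s i \<and> s i \<le> x \<and> V (s i) = V 0 + real i / real N * L"
      by metis
    \<comment> \<open>The intermediate value theorem does not place the first and last points at the ends of the interval, so they are set by hand.\<close>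
    define t where "t i = (if i = 0 then 0 else if i = N then x else s i)" for i
    have t: "t i \<in> {0..1} \<and> V (t i) = V 0 + real i / real N * L" if "i \<le> N" for i
      using s[OF that] x \<open>N > 0\<close> by (auto simp: t_def L_def)
    have "D x - D 0 = (\<Sum>i<N. D (t (Suc i)) - D (t i))"
      using \<open>N > 0\<close> by (subst sum_lessThan_telescope) (simp add: t_def)
    also have "norm \<dots> \<le> (\<Sum>i<N. C * (L / N)\<^sup>2)"
    proof (rule sum_norm_le)
      fix i assume "i \<in> {..<N}"
      then have "norm (D (t (Suc i)) - D (t i)) \<le> C * (V (t (Suc i)) - V (t i))\<^sup>2"
        using t by (intro D') auto
      also have "V (t (Suc i)) - V (t i) = L / N"
        using t \<open>i \<in> {..<N}\<close> by (simp add: field_simps)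
      finally show "norm (D (t (Suc i)) - D (t i)) \<le> C * (L / N)\<^sup>2" .
    qed
    also have "\<dots> = C * L\<^sup>2 / N"
      using \<open>N > 0\<close> by (simp add: power2_eq_square)
    finally show ?thesis .
  qed
  have "(\<lambda>N. C * L\<^sup>2 / real N) \<longlonglongrightarrow> 0"
    by (rule lim_const_over_n)
  then have "norm (D x - D 0) \<le> 0"
    by (rule tendsto_lowerbound) (auto intro!: eventually_sequentiallyI[of 1] bound)
  then show ?thesis by simp
qed

lemma absolutely_integrable_scaleR_continuous:
  fixes f :: "real \<Rightarrow> real" and G :: "real \<Rightarrow> 'a::euclidean_space"
  assumes "f absolutely_integrable_on {a..b}" "continuous_on {a..b} G"
  shows "(\<lambda>t. f t *\<^sub>R G t) absolutely_integrable_on {a..b}"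
proof -
  have "(\<lambda>t. (\<lambda>v r. r *\<^sub>R v) (G t) (f t)) absolutely_integrable_on {a..b}"
  proof (rule absolutely_integrable_bounded_measurable_product[where h="\<lambda>(v::'a) r. r *\<^sub>R v"])
    show "bilinear (\<lambda>(v::'a) r. r *\<^sub>R v)"
      using bilinear_conv_bounded_bilinear bounded_bilinear.flip bounded_bilinear_scaleR by blast
    show "G \<in> borel_measurable (lebesgue_on {a..b})"
      by (simp add: assms(2) continuous_imp_measurable_on_sets_lebesgue)
    show "bounded (G ` {a..b})"
      by (simp add: assms(2) compact_continuous_image compact_imp_bounded)
  qed (use assms in auto)
  then show ?thesis by simp
qed

lemma continuous_on_if_indefinite_integral:
  fixes F :: "real \<Rightarrow> 'a::euclidean_space"
  assumes "f absolutely_integrable_on {0..1}"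
    and "\<And>x. x \<in> {0..1} \<Longrightarrow> F x = F 0 + integral {0..x} f"
  shows "continuous_on {0..1} F"
proof -
  have "continuous_on {0..1} (\<lambda>x. F 0 + integral {0..x} f)"
    using assms(1) set_lebesgue_integral_eq_integral(1)
    by (intro continuous_intros indefinite_integral_continuous_1) auto
  then show ?thesis
    by (rule continuous_on_eq) (rule assms(2)[symmetric])
qed

lemma absolutely_integrable_subinterval:
  fixes f :: "real \<Rightarrow> 'a::euclidean_space"
  assumes "f absolutely_integrable_on {0..1}" "0 \<le> a" "b \<le> 1"
  shows "f absolutely_integrable_on {a..b}"
  using assms by (auto intro: absolutely_integrable_on_subinterval)

lemma has_integral_weighted:
  fixes f :: "real \<Rightarrow> real" and G :: "real \<Rightarrow> 'a::euclidean_space"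
  assumes "f absolutely_integrable_on {0..1}" "continuous_on {0..1} G" "x \<in> {0..1}"
  shows "((\<lambda>t. f t *\<^sub>R G t) has_integral (integral {0..x} (\<lambda>t. f t *\<^sub>R G t))) {0..x}"
proof -
  have "(\<lambda>t. f t *\<^sub>R G t) absolutely_integrable_on {0..x}"
    using absolutely_integrable_subinterval[OF absolutely_integrable_scaleR_continuous[OF assms(1,2)], of 0 x] assms(3)
    by simp
  then show ?thesis
    by (auto simp: absolutely_integrable_on_def)
qed

lemma norm_integral_weighted_le:
  fixes f :: "real \<Rightarrow> real" and G :: "real \<Rightarrow> 'a::euclidean_space"
  assumes "f absolutely_integrable_on {0..1}" "continuous_on {0..1} G" "x \<in> {0..1}"
    and B: "\<And>t. t \<in> {0..1} \<Longrightarrow> norm (G t) \<le> B"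
  shows "norm (integral {0..x} (\<lambda>t. f t *\<^sub>R G t)) \<le> integral {0..1} (\<lambda>t. \<bar>f t\<bar>) * B"
proof -
  have i1: "(\<lambda>t. \<bar>f t\<bar>) integrable_on {0..1}"
    using assms(1) by (simp add: absolutely_integrable_on_def)
  then have ix: "(\<lambda>t. \<bar>f t\<bar>) integrable_on {0..x}"
    using assms(3) by (auto elim!: integrable_subinterval_real)
  have B0: "B \<ge> 0" using order_trans[OF norm_ge_zero B[of 0]] by simp
  have "norm (integral {0..x} (\<lambda>t. f t *\<^sub>R G t)) \<le> integral {0..x} (\<lambda>t. \<bar>f t\<bar> * B)"
  proof (rule integral_norm_bound_integral)
    show "(\<lambda>t. f t *\<^sub>R G t) integrable_on {0..x}"
      using has_integral_weighted[OF assms(1-3)] by (rule has_integral_integrable)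
    show "norm (f t *\<^sub>R G t) \<le> \<bar>f t\<bar> * B" if "t \<in> {0..x}" for t
      using B[of t] that assms(3) by (auto intro: mult_left_mono)
  qed (use ix in \<open>auto intro: integrable_on_mult_left\<close>)
  also have "\<dots> = integral {0..x} (\<lambda>t. \<bar>f t\<bar>) * B" by simp
  also have "\<dots> \<le> integral {0..1} (\<lambda>t. \<bar>f t\<bar>) * B"
    using ix i1 assms(3) B0 by (intro mult_right_mono integral_subset_le) auto
  finally show ?thesis .
qed

text \<open>Absolute continuity of \<open>F\<close> and \<open>G\<close> is expressed by their being indefinite integrals.  On \<open>[a, b]\<close> the difference
  of the two sides is \<open>\<integral> f (G b - G t) - (F t - F a) g\<close>, and each difference of \<open>F\<close> or \<open>G\<close> is bounded by
  the variation over \<open>[a, b]\<close>.  Hence the difference is quadratically small in the variation, and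
  \<open>constant_if_increment_le_square\<close> applies.\<close>

theorem absolutely_continuous_integration_by_parts:
  fixes f F :: "real \<Rightarrow> real" and g G :: "real \<Rightarrow> 'a::euclidean_space"
  assumes f: "f absolutely_integrable_on {0..1}" and g: "g absolutely_integrable_on {0..1}"
    and F: "\<And>x. x \<in> {0..1} \<Longrightarrow> F x = F 0 + integral {0..x} f"
    and G: "\<And>x. x \<in> {0..1} \<Longrightarrow> G x = G 0 + integral {0..x} g"
    and x: "x \<in> {0..1}"
  shows "((\<lambda>t. f t *\<^sub>R G t + F t *\<^sub>R g t) has_integral (F x *\<^sub>R G x - F 0 *\<^sub>R G 0)) {0..x}"
proof -
  have cF: "continuous_on {0..1} F" by (rule continuous_on_if_indefinite_integral[OF f F])
  have cG: "continuous_on {0..1} G" by (rule continuous_on_if_indefinite_integral[OF g G])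
  have aFg: "(\<lambda>t. F t *\<^sub>R g t) absolutely_integrable_on {0..1}"
  proof (rule absolutely_integrable_bounded_measurable_product[where h="\<lambda>r (v::'a). r *\<^sub>R v"]) 
    show "bilinear (\<lambda>r (v::'a). r *\<^sub>R v)"
      using bilinear_conv_bounded_bilinear bounded_bilinear_scaleR by blast
    show "F \<in> borel_measurable (lebesgue_on {0..1})"
      by (simp add: cF continuous_imp_measurable_on_sets_lebesgue)
    show "bounded (F ` {0..1})"
      by (simp add: cF compact_continuous_image compact_imp_bounded)
  qed (use g in auto)
  have afG: "(\<lambda>t. f t *\<^sub>R G t) absolutely_integrable_on {0..1}"
    by (rule absolutely_integrable_scaleR_continuous[OF f cG])
  define h where "h t = f t *\<^sub>R G t + F t *\<^sub>R g t" for t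
  have ih: "h integrable_on {a..b}" if "0 \<le> a" "b \<le> 1" for a b
    unfolding h_def using absolutely_integrable_subinterval[OF aFg that] absolutely_integrable_subinterval[OF afG that]
    by (intro integrable_add) (auto dest: set_lebesgue_integral_eq_integral(1))
  define V where "V x = integral {0..x} (\<lambda>t. norm (f t)) + integral {0..x} (\<lambda>t. norm (g t))" for x
  define D where "D x = F x *\<^sub>R G x - integral {0..x} h" for x
  have nf: "(\<lambda>t. norm (f t)) integrable_on {0..1}" and ng: "(\<lambda>t. norm (g t)) integrable_on {0..1}"
    using f g by (auto simp: absolutely_integrable_on_def)
  have cV: "continuous_on {0..1} V"
    unfolding V_def using nf ng by (intro continuous_intros indefinite_integral_continuous_1)
  have incr: "norm (F b - F a) \<le> integral {a..b} (\<lambda>t. norm (f t))"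
       "norm (G b - G a) \<le> integral {a..b} (\<lambda>t. norm (g t))"
       "integral {a..b} (\<lambda>t. norm (f t)) \<le> V b - V a"
       "integral {a..b} (\<lambda>t. norm (g t)) \<le> V b - V a"
       "0 \<le> V b - V a"
       if ab: "0 \<le> a" "a \<le> b" "b \<le> 1" for a b
  proof -
    have i: "(\<lambda>t. norm (f t)) integrable_on {0..b}" "(\<lambda>t. norm (g t)) integrable_on {0..b}"
      using nf ng ab by (auto intro: integrable_subinterval_real)
    have e: "integral {0..b} (\<lambda>t. norm (f t)) - integral {0..a} (\<lambda>t. norm (f t)) = integral {a..b} (\<lambda>t. norm (f t))"
       "integral {0..b} (\<lambda>t. norm (g t)) - integral {0..a} (\<lambda>t. norm (g t)) = integral {a..b} (\<lambda>t. norm (g t))"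
      using Henstock_Kurzweil_Integration.integral_combine[OF ab(1,2) i(1)]
       Henstock_Kurzweil_Integration.integral_combine[OF ab(1,2) i(2)] by auto
    have p: "0 \<le> integral {a..b} (\<lambda>t. norm (f t))" "0 \<le> integral {a..b} (\<lambda>t. norm (g t))"
      using i ab by (auto intro!: integral_nonneg intro: integrable_subinterval_real)
    show "norm (F b - F a) \<le> integral {a..b} (\<lambda>t. norm (f t))"
      using norm_integral_increment_le[OF f ab] F[of a] F[of b] ab e by simp
    show "norm (G b - G a) \<le> integral {a..b} (\<lambda>t. norm (g t))"
      using norm_integral_increment_le[OF g ab] G[of a] G[of b] ab e by simp
    show "integral {a..b} (\<lambda>t. norm (f t)) \<le> V b - V a" "integral {a..b} (\<lambda>t. norm (g t)) \<le> V b - V a"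
      "0 \<le> V b - V a"
      using e p by (auto simp: V_def)
  qed
  have "D x = D 0"
  proof (rule constant_if_increment_le_square[OF cV _ x])
    fix a b :: real assume ab: "0 \<le> a" "a \<le> b" "b \<le> 1"
    define w where "w = V b - V a"
    have ifab: "f integrable_on {a..b}" "g integrable_on {a..b}"
        "(\<lambda>t. norm (f t)) integrable_on {a..b}" "(\<lambda>t. norm (g t)) integrable_on {a..b}"
      using absolutely_integrable_subinterval[OF f ab(1,3)] absolutely_integrable_subinterval[OF g ab(1,3)]
      by (auto simp: absolutely_integrable_on_def)
    have f1: "integral {a..b} f = F b - F a" and g1: "integral {a..b} g = G b - G a"
      using Henstock_Kurzweil_Integration.integral_combine[OF ab(1,2), of f]
        Henstock_Kurzweil_Integration.integral_combine[OF ab(1,2), of g]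
        absolutely_integrable_subinterval[OF f order.refl ab(3)] absolutely_integrable_subinterval[OF g order.refl ab(3)]
        F[of a] F[of b] G[of a] G[of b] ab
      by (auto simp: absolutely_integrable_on_def algebra_simps)
    have "integral {0..b} h = integral {0..a} h + integral {a..b} h"
      using Henstock_Kurzweil_Integration.integral_combine[OF ab(1,2) ih] ab by simp
    moreover have "F b *\<^sub>R G b - F a *\<^sub>R G a = integral {a..b} (\<lambda>t. f t *\<^sub>R G b + F a *\<^sub>R g t)"
    proof -
      have "((\<lambda>t. f t *\<^sub>R G b + F a *\<^sub>R g t) has_integral ((F b - F a) *\<^sub>R G b + F a *\<^sub>R (G b - G a))) {a..b}"
        unfolding f1[symmetric] g1[symmetric]
        by (intro has_integral_add has_integral_scaleR_left has_integral_cmul integrable_integral ifab)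
      then show ?thesis by (simp add: integral_unique algebra_simps)
    qed
    ultimately have "D b - D a = integral {a..b} (\<lambda>t. f t *\<^sub>R G b + F a *\<^sub>R g t) - integral {a..b} h"
      by (simp add: D_def algebra_simps)
    also have "\<dots> = integral {a..b} (\<lambda>t. (f t *\<^sub>R G b + F a *\<^sub>R g t) - h t)"
      using ifab ab by (intro integral_diff[symmetric] ih integrable_add integrable_cmul integrable_on_scaleR_left) auto
    also have "norm \<dots> \<le> integral {a..b} (\<lambda>t. norm (f t) * w + w * norm (g t))"
    proof (rule integral_norm_bound_integral)
      show "(\<lambda>t. f t *\<^sub>R G b + F a *\<^sub>R g t - h t) integrable_on {a..b}"
        using ifab ab by (intro integrable_diff ih integrable_add integrable_cmul integrable_on_scaleR_left) auto
      show "(\<lambda>t. norm (f t) * w + w * norm (g t)) integrable_on {a..b}"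
        using ifab by (intro integrable_add integrable_on_mult_left integrable_on_mult_right)
      fix t assume t: "t \<in> {a..b}"
      have "norm (G b - G t) \<le> w"
        using incr(2,4)[of t b] incr(5)[of a t] t ab by (auto simp: w_def)
      moreover have "norm (F t - F a) \<le> w"
        using incr(1,3)[of a t] incr(5)[of t b] t ab by (auto simp: w_def)
      moreover have "f t *\<^sub>R G b + F a *\<^sub>R g t - h t = f t *\<^sub>R (G b - G t) - (F t - F a) *\<^sub>R g t"
        by (simp add: h_def algebra_simps)
      moreover have "norm (f t *\<^sub>R (G b - G t) - (F t - F a) *\<^sub>R g t)
          \<le> norm (f t) * norm (G b - G t) + norm (F t - F a) * norm (g t)"
        by (metis norm_scaleR norm_triangle_ineq4 real_norm_def)
      ultimately show "norm (f t *\<^sub>R G b + F a *\<^sub>R g t - h t) \<le> norm (f t) * w + w * norm (g t)"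
        by (smt (verit) mult_left_mono mult_right_mono norm_ge_zero)
    qed
    also have "\<dots> = integral {a..b} (\<lambda>t. norm (f t)) * w + w * integral {a..b} (\<lambda>t. norm (g t))"
      using ifab by (subst Henstock_Kurzweil_Integration.integral_add) (auto intro: integrable_on_mult_left integrable_on_mult_right)
    also have "\<dots> \<le> w * w + w * w"
      using incr(3-5)[OF ab] ifab by (intro add_mono mult_mono) (auto simp: w_def intro!: integral_nonneg)
    finally show "norm (D b - D a) \<le> 2 * (V b - V a)\<^sup>2"
      by (simp add: w_def power2_eq_square)
  next
    show "V 0 \<le> V x" using incr(5)[of 0 x] x by simp
  qed
  then have "integral {0..x} h = F x *\<^sub>R G x - F 0 *\<^sub>R G 0"
    by (simp add: D_def diff_eq_eq eq_diff_eq add.commute)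
  then show ?thesis
    using ih[of 0 x] x by (simp add: h_def[abs_def] has_integral_integrable_integral)
qed

section \<open>A uniform Riemann-Lebesgue lemma\<close>

text \<open>A measurable function is an almost everywhere limit of continuous functions \<open>g n\<close>.  Truncating both at a high
  level \<open>k\<close> gives a bounded sequence, so convergence in mean follows by dominated convergence; the truncation of the
  limit costs little because \<open>f\<close> is integrable.\<close>

lemma L1_approximation_by_continuous:
  fixes f :: "real \<Rightarrow> real"
  assumes f: "f absolutely_integrable_on {0..1}" and e: "e > 0"
  obtains g where "continuous_on UNIV g" "integral {0..1} (\<lambda>t. \<bar>f t - g t\<bar>) < e"
proof -
  define \<phi> :: "real \<Rightarrow> real \<Rightarrow> real" where "\<phi> M t = max (- M) (min M t)" for M t
  have \<phi>_cont: "continuous_on UNIV (\<phi> M)" for M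
    unfolding \<phi>_def by (intro continuous_intros)
  have \<phi>_bound: "\<bar>\<phi> M t\<bar> \<le> M" "\<bar>\<phi> M t - t\<bar> \<le> \<bar>t\<bar>" if "M \<ge> 0" for M t
    using that by (auto simp: \<phi>_def)
  have f_meas: "f \<in> borel_measurable (lebesgue_on {0..1})"
    using f by (rule absolutely_integrable_imp_borel_measurable) auto
  have \<phi>f_meas: "(\<lambda>t. \<phi> M (f t)) \<in> borel_measurable (lebesgue_on {0..1})" for M
    using f_meas by (simp add: \<phi>_def)
  have nf: "(\<lambda>t. \<bar>f t\<bar>) integrable_on {0..1}"
    using f by (simp add: absolutely_integrable_on_def)
  have int1: "(\<lambda>t. \<bar>\<phi> (real k) (f t) - f t\<bar>) integrable_on {0..1}" for k
    by (rule measurable_bounded_by_integrable_imp_integrable[OF _ nf])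
       (use \<phi>f_meas f_meas \<phi>_bound in auto)
  have "(\<lambda>k. integral {0..1} (\<lambda>t. \<bar>\<phi> (real k) (f t) - f t\<bar>)) \<longlonglongrightarrow> integral {0..1} (\<lambda>t::real. 0)"
  proof (rule dominated_convergence(2)[where h="\<lambda>t. \<bar>f t\<bar>"])
    fix t :: real
    obtain k0 :: nat where "\<bar>f t\<bar> \<le> real k0" using real_arch_simple by blast
    then have "\<forall>\<^sub>F k in sequentially. \<bar>\<phi> (real k) (f t) - f t\<bar> = 0"
      by (intro eventually_sequentiallyI[of k0]) (auto simp: \<phi>_def)
    then show "(\<lambda>k. \<bar>\<phi> (real k) (f t) - f t\<bar>) \<longlonglongrightarrow> 0"
      by (rule tendsto_eventually)
  qed (use \<phi>_bound int1 nf in auto)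
  then have "\<forall>\<^sub>F k in sequentially. integral {0..1} (\<lambda>t. \<bar>\<phi> (real k) (f t) - f t\<bar>) < e / 2"
    using e by (intro order_tendstoD(2)) auto
  then obtain k where k: "integral {0..1} (\<lambda>t. \<bar>\<phi> (real k) (f t) - f t\<bar>) < e / 2"
    by (auto simp: eventually_sequentially)
  have "f measurable_on {0..1}"
    using f_meas by (simp add: measurable_on_iff_borel_measurable)
  then obtain N g where N: "negligible N" and g_cont: "\<And>n. continuous_on UNIV (g n)"
    and g_lim: "\<And>x. x \<notin> N \<Longrightarrow> (\<lambda>n. g n x) \<longlonglongrightarrow> (if x \<in> {0..1} then f x else (0::real))"
    unfolding measurable_on_def by blast
  have \<phi>g_cont: "continuous_on UNIV (\<lambda>t. \<phi> M (g n t))" for M n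
    by (rule continuous_on_compose2[OF \<phi>_cont g_cont]) auto
  have \<phi>g_meas: "(\<lambda>t. \<phi> M (g n t)) \<in> borel_measurable (lebesgue_on {0..1})" for M n
    by (rule continuous_imp_measurable_on_sets_lebesgue)
       (auto intro: continuous_on_subset[OF \<phi>g_cont])
  have int2: "(\<lambda>t. \<bar>\<phi> (real k) (g n t) - \<phi> (real k) (f t)\<bar>) integrable_on {0..1}" for n
  proof (rule measurable_bounded_by_integrable_imp_integrable[where g="\<lambda>t. 2 * real k"])
    fix t :: real
    show "norm \<bar>\<phi> (real k) (g n t) - \<phi> (real k) (f t)\<bar> \<le> 2 * real k"
      using \<phi>_bound(1)[of "real k" "g n t"] \<phi>_bound(1)[of "real k" "f t"] by auto
  qed (use \<phi>g_meas \<phi>f_meas in auto)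
  define d where "d n t = (if t \<in> N then 0 else \<bar>\<phi> (real k) (g n t) - \<phi> (real k) (f t)\<bar>)" for n t
  have spike: "integral {0..1} (d n) = integral {0..1} (\<lambda>t. \<bar>\<phi> (real k) (g n t) - \<phi> (real k) (f t)\<bar>)" for n
    by (rule integral_spike[OF N]) (auto simp: d_def)
  have "(\<lambda>n. integral {0..1} (d n)) \<longlonglongrightarrow> integral {0..1} (\<lambda>t::real. 0)"
  proof (rule dominated_convergence(2)[where h="\<lambda>t. 2 * real k"])
    show "d n integrable_on {0..1}" for n
      by (rule integrable_spike[OF int2 N]) (auto simp: d_def)
    show "norm (d n t) \<le> 2 * real k" for n t
      using \<phi>_bound(1)[of "real k" "g n t"] \<phi>_bound(1)[of "real k" "f t"] by (auto simp: d_def)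
    show "(\<lambda>n. d n t) \<longlonglongrightarrow> 0" if "t \<in> {0..1}" for t
    proof (cases "t \<in> N")
      case False
      have "(\<lambda>n. \<phi> (real k) (g n t)) \<longlonglongrightarrow> \<phi> (real k) (f t)"
        using g_lim[OF False] that by (auto simp: \<phi>_def intro!: tendsto_intros)
      then have "(\<lambda>n. \<bar>\<phi> (real k) (g n t) - \<phi> (real k) (f t)\<bar>) \<longlonglongrightarrow> \<bar>\<phi> (real k) (f t) - \<phi> (real k) (f t)\<bar>"
        by (intro tendsto_intros)
      then show ?thesis using False by (simp add: d_def)
    qed (simp add: d_def)
  qed auto
  then have "\<forall>\<^sub>F n in sequentially. integral {0..1} (d n) < e / 2"
    using e by (intro order_tendstoD(2)) auto
  then obtain n where n: "integral {0..1} (\<lambda>t. \<bar>\<phi> (real k) (g n t) - \<phi> (real k) (f t)\<bar>) < e / 2"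
    by (auto simp: eventually_sequentially spike)
  have "integral {0..1} (\<lambda>t. \<bar>f t - \<phi> (real k) (g n t)\<bar>)
    \<le> integral {0..1} (\<lambda>t. \<bar>\<phi> (real k) (f t) - f t\<bar> + \<bar>\<phi> (real k) (g n t) - \<phi> (real k) (f t)\<bar>)"
  proof (rule integral_le)
    show "(\<lambda>t. \<bar>f t - \<phi> (real k) (g n t)\<bar>) integrable_on {0..1}"
      by (rule measurable_bounded_by_integrable_imp_integrable[OF _ integrable_add[OF int1[of k] int2[of n]]])
         (use \<phi>g_meas f_meas in auto)
  qed (auto intro: integrable_add int1 int2)
  also have "\<dots> < e"
    using k n by (subst Henstock_Kurzweil_Integration.integral_add[OF int1 int2]) auto
  finally show ?thesis
    by (intro that[OF \<phi>g_cont]) auto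
qed

lemma L1_approximation_by_polynomial:
  fixes f :: "real \<Rightarrow> real"
  assumes f: "f absolutely_integrable_on {0..1}" and e: "e > 0"
  obtains g where "real_polynomial_function g" "integral {0..1} (\<lambda>t. \<bar>f t - g t\<bar>) < e"
proof -
  obtain g where g: "continuous_on UNIV g" "integral {0..1} (\<lambda>t. \<bar>f t - g t\<bar>) < e / 2"
    using L1_approximation_by_continuous[OF f, of "e / 2"] e by auto
  have g': "continuous_on {0..1} g" using g(1) continuous_on_subset by blast
  obtain p where p: "real_polynomial_function p" "\<And>t. t \<in> {0..1} \<Longrightarrow> \<bar>g t - p t\<bar> < e / 2"
    using Stone_Weierstrass_real_polynomial_function[of "{0..1}" g "e / 2"] e g' by auto
  have p': "continuous_on {0..1} p"
    using p(1) continuous_on_polymonial_function real_polynomial_function_eq by blast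
  have int: "(\<lambda>t. \<bar>f t - h t\<bar>) integrable_on {0..1}" if "continuous_on {0..1} h" for h
  proof -
    have "(\<lambda>t. f t - h t) absolutely_integrable_on {0..1}"
      using f absolutely_integrable_continuous_real[OF that] by (rule set_integral_diff(1))
    then show ?thesis by (simp add: absolutely_integrable_on_def)
  qed
  have "integral {0..1} (\<lambda>t. \<bar>f t - p t\<bar>) \<le> integral {0..1} (\<lambda>t. \<bar>f t - g t\<bar> + e / 2)"
  proof (rule integral_le)
    fix t :: real assume "t \<in> {0..1}"
    then show "\<bar>f t - p t\<bar> \<le> \<bar>f t - g t\<bar> + e / 2"
      using p(2)[of t] by linarith
  qed (auto intro!: int p' g' integrable_add)
  also have "\<dots> = integral {0..1} (\<lambda>t. \<bar>f t - g t\<bar>) + e / 2"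
    by (subst Henstock_Kurzweil_Integration.integral_add) (auto intro!: int g')
  also have "\<dots> < e" using g(2) by simp
  finally show ?thesis using that p(1) by blast
qed

lemma has_vector_derivative_cis:
  "((\<lambda>t. cis (a * t)) has_vector_derivative (\<i> * a * cis (a * t))) (at t within S)"
proof -
  have "((\<lambda>t. exp (\<i> * (of_real a * of_real t))) has_vector_derivative (\<i> * a * exp (\<i> * (of_real a * of_real t)))) (at t within S)"
    by (auto intro!: derivative_eq_intros has_vector_derivative_real_field simp: mult_ac)
  then show ?thesis by (simp add: cis_conv_exp)
qed

text \<open>For a polynomial \<open>g\<close>, integration by parts gives a bound of order \<open>1 / \<bar>w\<bar>\<close> that does not depend on the upper
  limit \<open>x\<close>; replacing \<open>f\<close> by \<open>g\<close> changes the integral by at most the distance in mean, again independently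
  of \<open>x\<close>.\<close>

theorem Riemann_Lebesgue_uniform:
  fixes f :: "real \<Rightarrow> real"
  assumes f: "f absolutely_integrable_on {0..1}" and e: "e > 0"
  obtains W where "\<And>w x. \<lbrakk>\<bar>w\<bar> \<ge> W; x \<in> {0..1}\<rbrakk>
    \<Longrightarrow> norm (integral {0..x} (\<lambda>t. f t *\<^sub>R cis (w * t))) < e"
proof -
  obtain g where g: "real_polynomial_function g" "integral {0..1} (\<lambda>t. \<bar>f t - g t\<bar>) < e / 2"
    using L1_approximation_by_polynomial[OF f, of "e / 2"] e by auto
  obtain g' where g': "real_polynomial_function g'"
    "\<And>t. (g has_real_derivative g' t) (at t)"
    using has_real_derivative_polynomial_function[OF g(1)] by blast
  have cont: "continuous_on {0..1} g" "continuous_on {0..1} g'"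
    using g(1) g'(1) continuous_on_polymonial_function real_polynomial_function_eq by blast+
  obtain B where B: "\<And>t. t \<in> {0..1} \<Longrightarrow> \<bar>g t\<bar> \<le> B" "\<And>t. t \<in> {0..1} \<Longrightarrow> \<bar>g' t\<bar> \<le> B"
  proof -
    obtain B1 B2 where "\<forall>t\<in>{0..1}. \<bar>g t\<bar> \<le> B1" "\<forall>t\<in>{0..1}. \<bar>g' t\<bar> \<le> B2"
      using compact_continuous_image[OF cont(1)] compact_continuous_image[OF cont(2)]
      by (metis compact_Icc compact_imp_bounded bounded_iff image_eqI real_norm_def)
    then show ?thesis by (intro that[of "max B1 B2"]) (auto simp: le_max_iff_disj)
  qed
  have B0: "B \<ge> 0" using B(1)[of 0] by auto
  show ?thesis
  proof
    fix w x :: real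
    \<comment> \<open>The integration by parts produces three terms of size at most \<open>B / \<bar>w\<bar>\<close>, which have to stay below \<open>e / 2\<close>.\<close>
    assume w: "\<bar>w\<bar> \<ge> 6 * B / e + 1" and x: "x \<in> {0..1}"
    have "6 * B / e \<ge> 0" using B0 e by simp
    with w have w0: "w \<noteq> 0" "\<bar>w\<bar> > 0" by auto
    define E where "E t = (1 / (\<i> * w)) * cis (w * t)" for t
    have E: "(E has_vector_derivative cis (w * t)) (at t within {0..x})" for t
      unfolding E_def using w0
      by (auto intro!: derivative_eq_intros has_vector_derivative_cis)
    have normE: "norm (E t) = 1 / \<bar>w\<bar>" for t
      by (simp add: E_def norm_mult norm_divide)
    have "((\<lambda>t. g t *\<^sub>R cis (w * t) + g' t *\<^sub>R E t) has_integral (g x *\<^sub>R E x - g 0 *\<^sub>R E 0)) {0..x}"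
    proof (rule fundamental_theorem_of_calculus)
      fix t assume "t \<in> {0..x}"
      show "((\<lambda>t. g t *\<^sub>R E t) has_vector_derivative g t *\<^sub>R cis (w * t) + g' t *\<^sub>R E t) (at t within {0..x})"
        by (rule has_vector_derivative_scaleR[OF DERIV_subset[OF g'(2)] E]) simp
    qed (use x in auto)
    moreover have i2: "(\<lambda>t. g' t *\<^sub>R E t) integrable_on {0..x}"
      using x unfolding E_def
      by (intro integrable_continuous_interval continuous_intros continuous_on_subset[OF cont(2)]) auto
    ultimately have "((\<lambda>t. g t *\<^sub>R cis (w * t)) has_integral
        (g x *\<^sub>R E x - g 0 *\<^sub>R E 0) - integral {0..x} (\<lambda>t. g' t *\<^sub>R E t)) {0..x}"
      using has_integral_diff[OF _ integrable_integral[OF i2]] by fastforce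
    then have ig: "(\<lambda>t. g t *\<^sub>R cis (w * t)) integrable_on {0..x}"
      and ig_eq: "integral {0..x} (\<lambda>t. g t *\<^sub>R cis (w * t))
       = (g x *\<^sub>R E x - g 0 *\<^sub>R E 0) - integral {0..x} (\<lambda>t. g' t *\<^sub>R E t)"
      by (auto simp: integral_unique has_integral_integrable)
    have "norm ((g x *\<^sub>R E x - g 0 *\<^sub>R E 0) - integral {0..x} (\<lambda>t. g' t *\<^sub>R E t))
      \<le> (B * (1 / \<bar>w\<bar>) + B * (1 / \<bar>w\<bar>)) + B * (1 / \<bar>w\<bar>)"
    proof (intro order_trans[OF norm_triangle_ineq4] add_mono)
      show "norm (g x *\<^sub>R E x) \<le> B * (1 / \<bar>w\<bar>)" "norm (g 0 *\<^sub>R E 0) \<le> B * (1 / \<bar>w\<bar>)"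
        unfolding norm_scaleR normE using B x by (auto intro!: mult_right_mono divide_right_mono)
      have "norm (integral {0..x} (\<lambda>t. g' t *\<^sub>R E t)) \<le> B * (1 / \<bar>w\<bar>) * (x - 0)"
      proof (rule integral_bound)
        show "continuous_on {0..x} (\<lambda>t. g' t *\<^sub>R E t)"
          using x unfolding E_def
          by (intro continuous_intros continuous_on_subset[OF cont(2)]) auto
        show "norm (g' t *\<^sub>R E t) \<le> B * (1 / \<bar>w\<bar>)" if "t \<in> {0..x}" for t
          unfolding norm_scaleR normE using B x that by (auto intro!: divide_right_mono)
      qed (use x in auto)
      also have "\<dots> \<le> B * (1 / \<bar>w\<bar>) * 1"
        using B0 x by (intro mult_left_mono) auto
      finally show "norm (integral {0..x} (\<lambda>t. g' t *\<^sub>R E t)) \<le> B * (1 / \<bar>w\<bar>)" by simp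
    qed
    moreover have "(B * (1 / \<bar>w\<bar>) + B * (1 / \<bar>w\<bar>)) + B * (1 / \<bar>w\<bar>) < e / 2"
    proof -
      have "\<bar>w\<bar> * e > 6 * B" using w e by (simp add: field_simps)
      then show ?thesis using w0 by (simp add: field_simps)
    qed
    ultimately have 1: "norm (integral {0..x} (\<lambda>t. g t *\<^sub>R cis (w * t))) < e / 2"
      unfolding ig_eq by (rule order_le_less_trans)
    have ad: "(\<lambda>t. f t - g t) absolutely_integrable_on {0..1}"
      using f absolutely_integrable_continuous_real[OF cont(1)] by (rule set_integral_diff(1))
    have wd: "((\<lambda>t. (f t - g t) *\<^sub>R cis (w * t)) has_integral
        integral {0..x} (\<lambda>t. (f t - g t) *\<^sub>R cis (w * t))) {0..x}"
      by (rule has_integral_weighted[OF ad _ x]) (intro continuous_intros)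
    then have id: "(\<lambda>t. (f t - g t) *\<^sub>R cis (w * t)) integrable_on {0..x}"
      by (rule has_integral_integrable)
    have "norm (integral {0..x} (\<lambda>t. (f t - g t) *\<^sub>R cis (w * t))) \<le> integral {0..1} (\<lambda>t. \<bar>f t - g t\<bar>) * 1"
      by (rule norm_integral_weighted_le[OF ad _ x]) (auto intro!: continuous_intros)
    then have 2: "norm (integral {0..x} (\<lambda>t. (f t - g t) *\<^sub>R cis (w * t))) < e / 2"
      using g(2) by simp
    have "integral {0..x} (\<lambda>t. f t *\<^sub>R cis (w * t))
      = integral {0..x} (\<lambda>t. (f t - g t) *\<^sub>R cis (w * t) + g t *\<^sub>R cis (w * t))"
      by (simp add: algebra_simps)
    also have "\<dots> = integral {0..x} (\<lambda>t. (f t - g t) *\<^sub>R cis (w * t)) + integral {0..x} (\<lambda>t. g t *\<^sub>R cis (w * t))"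
      by (rule Henstock_Kurzweil_Integration.integral_add[OF id ig])
    finally show "norm (integral {0..x} (\<lambda>t. f t *\<^sub>R cis (w * t))) < e"
      using norm_add_less[OF 2 1] by simp
  qed
qed

section \<open>Waves of integer frequency\<close>

lemma has_integral_cis_full_period:
  assumes "k \<noteq> 0" "k \<in> \<int>"
  shows "((\<lambda>t. cis (2 * pi * k * t)) has_integral 0) {0..1}"
proof -
  define E where "E t = (1 / (\<i> * (2 * pi * k))) * cis (2 * pi * k * t)" for t
  have "(E has_vector_derivative cis (2 * pi * k * t)) (at t within {0..1})" for t
    unfolding E_def using assms
    by (auto intro!: derivative_eq_intros has_vector_derivative_cis)
  then have "((\<lambda>t. cis (2 * pi * k * t)) has_integral (E 1 - E 0)) {0..1}"
    by (intro fundamental_theorem_of_calculus) auto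
  moreover have "cis (2 * pi * k) = 1"
    using cis_multiple_2pi[OF assms(2)] by simp
  ultimately show ?thesis by (simp add: E_def)
qed

text \<open>The general real solution of \<open>y'' + w\<^sup>2 y = 0\<close>, parametrised by the complex amplitude \<open>c\<close> of \<open>exp (iwt)\<close>.\<close>

definition wave :: "real \<Rightarrow> complex \<Rightarrow> real \<Rightarrow> real" where
  "wave w c t = 2 * Re (c * cis (w * t))"

lemma of_real_wave: "of_real (wave w c t) = c * cis (w * t) + cnj c * cis (- (w * t))"
  by (simp add: wave_def complex_eq_iff)

lemma abs_wave_le: "\<bar>wave w c t\<bar> \<le> 2 * cmod c"
proof -
  have "\<bar>Re (c * cis (w * t))\<bar> \<le> cmod (c * cis (w * t))" by (rule abs_Re_le_cmod)
  then show ?thesis by (simp add: wave_def norm_mult)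
qed

lemma continuous_on_wave [continuous_intros]: "continuous_on S (wave w c)"
  unfolding wave_def by (intro continuous_intros)

lemma scaleR_wave_cis:
  "wave w c t *\<^sub>R cis (- (w * t)) = c + cnj c * cis (- (2 * w * t))"
  by (simp add: scaleR_conv_of_real of_real_wave algebra_simps cis_mult flip: mult_2)

lemma has_integral_const_unit_interval: "((\<lambda>t. a) has_integral (a::'a::euclidean_space)) {0..1::real}"
  using has_integral_const_real[of a 0 1] by simp

lemma has_integral_wave_cis:
  assumes "n > 0" "w = 2 * pi * real n"
  shows "((\<lambda>t. wave w c t *\<^sub>R cis (- (w * t))) has_integral c) {0..1}"
proof -
  have "((\<lambda>t. c + cnj c * cis (2 * pi * (- 2 * real n) * t)) has_integral c + cnj c * 0) {0..1}"
    using assms by (intro has_integral_add has_integral_const_unit_interval has_integral_mult_right has_integral_cis_full_period) simp_all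
  then show ?thesis
    unfolding scaleR_wave_cis assms(2) by (simp add: mult_ac)
qed

lemma has_integral_wave_mult_wave:
  assumes "n > 0" "w = 2 * pi * real n"
  shows "((\<lambda>t. wave w a t * wave w b t) has_integral (2 * Re (a * cnj b))) {0..1}"
proof -
  have "((\<lambda>t. 2 * Re (a * cnj b) + 2 * Re (a * b * cis (2 * pi * (2 * real n) * t)))
     has_integral 2 * Re (a * cnj b) + 2 * Re (a * b * 0)) {0..1}"
    using assms
    by (intro has_integral_add has_integral_const_unit_interval has_integral_mult_right
        has_integral_linear[OF _ bounded_linear_Re, unfolded o_def] has_integral_cis_full_period) simp_all
  moreover have "wave w a t * wave w b t = 2 * Re (a * cnj b) + 2 * Re (a * b * cis (2 * pi * (2 * real n) * t))" for t
  proof -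
    have "complex_of_real (wave w a t * wave w b t)
      = (a * cnj b + cnj a * b) + (a * b * cis (2 * (w * t)) + cnj (a * b * cis (2 * (w * t))))"
      by (simp add: of_real_wave algebra_simps cis_mult mult_2 cis_cnj)
    also have "\<dots> = of_real (2 * Re (a * cnj b) + 2 * Re (a * b * cis (2 * (w * t))))"
      by (simp add: complex_eq_iff algebra_simps)
    finally show ?thesis unfolding of_real_eq_iff assms(2) by (simp add: mult_ac)
  qed
  ultimately show ?thesis by simp
qed

section \<open>Periodic solutions of the eigenvalue equation\<close>

text \<open>Real eigenfunctions with their derivative \<open>z\<close> carried along.  The equation is stated in integrated form,
  which says at once that \<open>z\<close> is absolutely continuous and that \<open>- z' + q y = l y\<close> almost everywhere.\<close>

locale periodic_solution =
  fixes q :: "real \<Rightarrow> real" and l :: real and y z :: "real \<Rightarrow> real"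
  assumes q_int: "q absolutely_integrable_on {0..1}"
    and y_deriv: "x \<in> {0..1} \<Longrightarrow> (y has_real_derivative z x) (at x within {0..1})"
    and z_eq: "x \<in> {0..1} \<Longrightarrow> z x = z 0 + integral {0..x} (\<lambda>t. (q t - l) * y t)"
    and y_periodic: "y 1 = y 0" and z_periodic: "z 1 = z 0"
begin

lemma y_cont: "continuous_on {0..1} y"
  using y_deriv DERIV_continuous_on by blast

lemma shifted_q_int: "(\<lambda>t. q t - a) absolutely_integrable_on {0..1}"
  using q_int absolutely_integrable_continuous_real[OF continuous_on_const] by (rule set_integral_diff(1))

lemma y''_int: "(\<lambda>t. (q t - l) * y t) absolutely_integrable_on {0..1}"
  using absolutely_integrable_scaleR_continuous[OF shifted_q_int y_cont] by simp

lemma z_cont: "continuous_on {0..1} z"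
  by (rule continuous_on_if_indefinite_integral[OF y''_int z_eq])

lemma y_eq: "x \<in> {0..1} \<Longrightarrow> y x = y 0 + integral {0..x} z"
proof -
  assume x: "x \<in> {0..1}"
  have "(z has_integral (y x - y 0)) {0..x}"
  proof (rule fundamental_theorem_of_calculus)
    fix t assume "t \<in> {0..x}"
    then show "(y has_vector_derivative z t) (at t within {0..x})"
      using DERIV_subset[OF y_deriv, of t "{0..x}"] x
      by (auto simp: has_real_derivative_iff_has_vector_derivative)
  qed (use x in auto)
  then show ?thesis by (simp add: integral_unique)
qed

end

text \<open>Symmetry of the operator: integrating \<open>(z1 y2)'\<close> and \<open>(z2 y1)'\<close> over the period gives zero for both, and the difference
  of the two integrands is \<open>(l2 - l1) y1 y2\<close>.\<close>

lemma periodic_solutions_orthogonal: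
  assumes "periodic_solution q l1 y1 z1" "periodic_solution q l2 y2 z2" "l1 \<noteq> l2"
  shows "integral {0..1} (\<lambda>t. y1 t * y2 t) = 0"
proof -
  interpret A: periodic_solution q l1 y1 z1 by fact
  interpret B: periodic_solution q l2 y2 z2 by fact
  have 1: "((\<lambda>t. ((q t - l1) * y1 t) *\<^sub>R y2 t + z1 t *\<^sub>R z2 t) has_integral (z1 1 *\<^sub>R y2 1 - z1 0 *\<^sub>R y2 0)) {0..1}"
    by (rule absolutely_continuous_integration_by_parts[OF A.y''_int _ A.z_eq B.y_eq])
       (auto intro: absolutely_integrable_continuous_real B.z_cont)
  have 2: "((\<lambda>t. ((q t - l2) * y2 t) *\<^sub>R y1 t + z2 t *\<^sub>R z1 t) has_integral (z2 1 *\<^sub>R y1 1 - z2 0 *\<^sub>R y1 0)) {0..1}"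
    by (rule absolutely_continuous_integration_by_parts[OF B.y''_int _ B.z_eq A.y_eq])
       (auto intro: absolutely_integrable_continuous_real A.z_cont)
  have "((\<lambda>t. (l2 - l1) * (y1 t * y2 t)) has_integral 0) {0..1}"
    using has_integral_diff[OF 1 2] A.y_periodic A.z_periodic B.y_periodic B.z_periodic
    by (simp add: algebra_simps)
  then have "(l2 - l1) * integral {0..1} (\<lambda>t. y1 t * y2 t) = 0"
    by (metis integral_unique integral_mult_right)
  then show ?thesis using assms(3) by simp
qed

text \<open>The number \<open>n\<close> selects the frequency \<open>w\<close> with which the solution is compared.  It enters as a free parameter:
  closeness of \<open>l\<close> to \<open>w\<^sup>2\<close> is measured by \<open>\<epsilon>\<close> below.\<close>

locale normalized_periodic_solution = periodic_solution +
  fixes n :: nat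
  assumes n_pos: "n > 0" and y_norm: "integral {0..1} (\<lambda>t. (y t)\<^sup>2) = 1"
    and q_mean: "integral {0..1} q = 0"
begin

text \<open>The function \<open>p\<close> is the variation of constants for \<open>y'' + w\<^sup>2 y = 0\<close>: it is constant exactly for the solutions
  of that equation, and \<open>c\<close> is the amplitude of the wave with the same initial values as \<open>y\<close>.  The ratio \<open>\<epsilon>\<close>
  bounds how far \<open>y\<close> can be from this wave, relative to the maximum of \<open>\<bar>y\<bar>\<close>.\<close>

definition w where "w = 2 * pi * real n"
definition d where "d = l - w\<^sup>2"
definition u where "u = integral {0..1} (\<lambda>t. y t *\<^sub>R cis (- (w * t)))"
definition K where "K = integral {0..1} (\<lambda>t. \<bar>q t\<bar>)"
definition p where "p x = (z x + \<i> * w * y x) * cis (- (w * x))"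
definition c where "c = p 0 / (2 * \<i> * w)"
definition \<epsilon> where "\<epsilon> = (K + \<bar>d\<bar>) / w"
definition \<kappa> where "\<kappa> = integral {0..1} (\<lambda>t. q t *\<^sub>R cis (- (2 * w * t)))"

lemma w_pos: "w > 0" using n_pos by (simp add: w_def)

lemma K_nonneg: "K \<ge> 0"
  unfolding K_def using q_int by (intro integral_nonneg) (auto simp: absolutely_integrable_on_def)

lemma \<epsilon>_nonneg: "\<epsilon> \<ge> 0"
  using K_nonneg w_pos by (simp add: \<epsilon>_def)

lemma \<epsilon>_w: "K + \<bar>d\<bar> = \<epsilon> * w"
  using w_pos by (simp add: \<epsilon>_def)

text \<open>Formally, \<open>p' = (y'' + w\<^sup>2 y) exp (-iwx)\<close>: the terms containing \<open>y'\<close> cancel.  The product \<open>z exp (-iwx)\<close>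
  requires integration by parts for the absolutely continuous function \<open>z\<close>; the product \<open>y exp (-iwx)\<close> is
  continuously differentiable.\<close>

lemma p_eq:
  assumes x: "x \<in> {0..1}"
  shows "p x - p 0 = integral {0..x} (\<lambda>t. q t *\<^sub>R (y t *\<^sub>R cis (- (w * t))))
     - d *\<^sub>R integral {0..x} (\<lambda>t. y t *\<^sub>R cis (- (w * t)))"
proof -
  define G where "G t = cis (- (w * t))" for t
  have G_deriv: "(G has_vector_derivative - \<i> * w * G t) (at t within S)" for t S
    unfolding G_def using has_vector_derivative_cis[of "- w" t S] by simp
  have G_cont: "continuous_on S G" for S
    unfolding G_def by (intro continuous_intros)
  have G_eq: "G x = G 0 + integral {0..x} (\<lambda>t. - \<i> * w * G t)" if "x \<in> {0..1}" for x
  proof -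
    have "((\<lambda>t. - \<i> * w * G t) has_integral (G x - G 0)) {0..x}"
      using that by (intro fundamental_theorem_of_calculus G_deriv) auto
    then have "integral {0..x} (\<lambda>t. - \<i> * w * G t) = G x - G 0" by (rule integral_unique)
    then show ?thesis by simp
  qed
  have 1: "((\<lambda>t. ((q t - l) * y t) *\<^sub>R G t + z t *\<^sub>R (- \<i> * w * G t)) has_integral (z x *\<^sub>R G x - z 0 *\<^sub>R G 0)) {0..x}"
    by (rule absolutely_continuous_integration_by_parts[OF y''_int _ z_eq G_eq x])
       (auto intro!: absolutely_integrable_continuous_real continuous_intros G_cont)
  have 2: "((\<lambda>t. y t *\<^sub>R (\<i> * w * (- \<i> * w * G t)) + z t *\<^sub>R (\<i> * w * G t)) has_integral
      (y x *\<^sub>R (\<i> * w * G x) - y 0 *\<^sub>R (\<i> * w * G 0))) {0..x}"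
  proof (rule fundamental_theorem_of_calculus)
    fix t assume t: "t \<in> {0..x}"
    have "(y has_real_derivative z t) (at t within {0..x})"
      using DERIV_subset[OF y_deriv, of t "{0..x}"] x t by auto
    moreover have "((\<lambda>t. \<i> * w * G t) has_vector_derivative \<i> * w * (- \<i> * w * G t)) (at t within {0..x})"
      by (rule has_vector_derivative_mult_right[OF G_deriv])
    ultimately show "((\<lambda>t. y t *\<^sub>R (\<i> * w * G t)) has_vector_derivative
        y t *\<^sub>R (\<i> * w * (- \<i> * w * G t)) + z t *\<^sub>R (\<i> * w * G t)) (at t within {0..x})"
      by (rule has_vector_derivative_scaleR)
  qed (use x in auto)
  have "((\<lambda>t. q t *\<^sub>R (y t *\<^sub>R G t) - d *\<^sub>R (y t *\<^sub>R G t)) has_integral (p x - p 0)) {0..x}"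
  proof (rule has_integral_eq_rhs[OF has_integral_eq[OF _ has_integral_add[OF 1 2]]])
    fix t
    show "((q t - l) * y t) *\<^sub>R G t + z t *\<^sub>R (- \<i> * w * G t) +
      (y t *\<^sub>R (\<i> * w * (- \<i> * w * G t)) + z t *\<^sub>R (\<i> * w * G t))
      = q t *\<^sub>R (y t *\<^sub>R G t) - d *\<^sub>R (y t *\<^sub>R G t)"
      by (simp add: d_def scaleR_conv_of_real algebra_simps power2_eq_square)
  qed (simp add: p_def G_def scaleR_conv_of_real algebra_simps)
  moreover have "((\<lambda>t. q t *\<^sub>R (y t *\<^sub>R G t) - d *\<^sub>R (y t *\<^sub>R G t)) has_integral
      integral {0..x} (\<lambda>t. q t *\<^sub>R (y t *\<^sub>R G t)) - d *\<^sub>R integral {0..x} (\<lambda>t. y t *\<^sub>R G t)) {0..x}"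
    using x
    by (intro has_integral_diff has_integral_cmul has_integral_weighted[OF q_int] integrable_integral
         integrable_continuous_interval continuous_intros G_cont y_cont continuous_on_subset[OF y_cont]) auto
  ultimately show ?thesis
    unfolding G_def by (rule has_integral_unique)
qed

lemma y_eq_p: "y x = Im (p x * cis (w * x)) / w"
  using w_pos by (simp add: p_def mult.assoc cis_mult)

lemma wave_eq_p: "wave w c x = Im (p 0 * cis (w * x)) / w"
proof -
  have "p 0 = 2 * \<i> * w * c" using w_pos by (simp add: c_def)
  then show ?thesis using w_pos by (simp add: wave_def field_simps)
qed

lemma y_minus_wave: "y x - wave w c x = Im ((p x - p 0) * cis (w * x)) / w"
  by (simp only: y_eq_p wave_eq_p left_diff_distrib minus_complex.simps diff_divide_distrib)

lemma abs_y_minus_wave_le: "\<bar>y x - wave w c x\<bar> \<le> cmod (p x - p 0) / w"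
proof -
  have "\<bar>Im ((p x - p 0) * cis (w * x))\<bar> \<le> cmod (p x - p 0)"
    using abs_Im_le_cmod[of "(p x - p 0) * cis (w * x)"] by (simp add: norm_mult)
  then show ?thesis
    using w_pos by (simp add: y_minus_wave divide_right_mono)
qed

lemma yG_cont: "continuous_on {0..1} (\<lambda>t. y t *\<^sub>R cis (- (w * t)))"
  by (intro continuous_intros y_cont)

text \<open>Periodicity of \<open>y\<close>, \<open>y'\<close> and \<open>exp (-iwx)\<close> makes \<open>p 1 = p 0\<close>, so the total increment of \<open>p\<close> vanishes.  This is
  the eigenvalue equation tested against \<open>exp (iwx)\<close>.\<close>

lemma d_u_eq: "d *\<^sub>R u = integral {0..1} (\<lambda>t. q t *\<^sub>R (y t *\<^sub>R cis (- (w * t))))"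
proof -
  have "cis (- w) = 1"
    using cis_multiple_2pi[of "- real n"] by (simp add: w_def)
  then have "p 1 = p 0" using y_periodic z_periodic by (simp add: p_def)
  then show ?thesis using p_eq[of 1] by (simp add: u_def)
qed

lemma p_increment_le:
  assumes x: "x \<in> {0..1}" and M: "\<And>t. t \<in> {0..1} \<Longrightarrow> \<bar>y t\<bar> \<le> M"
  shows "cmod (p x - p 0) \<le> \<epsilon> * w * M"
proof -
  have "cmod (integral {0..x} (\<lambda>t. q t *\<^sub>R (y t *\<^sub>R cis (- (w * t))))) \<le> K * M"
    unfolding K_def by (rule norm_integral_weighted_le[OF q_int yG_cont x]) (simp add: M)
  moreover have "cmod (integral {0..x} (\<lambda>t. y t *\<^sub>R cis (- (w * t)))) \<le> M * (x - 0)"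
    using x M by (intro integral_bound continuous_on_subset[OF yG_cont]) auto
  moreover have "M * (x - 0) \<le> M * 1"
    using x M[of 0] by (intro mult_left_mono) auto
  ultimately have "cmod (p x - p 0) \<le> K * M + \<bar>d\<bar> * M"
    unfolding p_eq[OF x]
    by (intro order_trans[OF norm_triangle_ineq4] add_mono) (auto intro!: mult_left_mono)
  then show ?thesis by (simp flip: \<epsilon>_w add: distrib_right)
qed

end

section \<open>First-order asymptotics of an eigenfunction\<close>

context normalized_periodic_solution
begin

context
  assumes small: "\<epsilon> \<le> 1 / 50"
begin

text \<open>Let \<open>M\<close> be the maximum of \<open>\<bar>y\<bar>\<close>.  The wave has mean square \<open>2 \<bar>c\<bar>\<^sup>2\<close>, so normalisation of \<open>y\<close> fixes
  \<open>\<bar>c\<bar>\<close> up to \<open>\<epsilon> M\<close>, while \<open>M \<le> 2 \<bar>c\<bar> + \<epsilon> M\<close>; for small \<open>\<epsilon>\<close> the two estimates close up.  The constants are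
  generous roundings of the limit \<open>\<bar>c\<bar> = 1 / \<surd>2\<close>.\<close>

lemma coarse_asymptotics:
  shows abs_y_le: "t \<in> {0..1} \<Longrightarrow> \<bar>y t\<bar> \<le> 2"
    and norm_c_le: "cmod c \<le> 4 / 5"
    and norm_c_ge: "33 / 50 \<le> cmod c"
    and norm_c_sq: "\<bar>1 - 2 * (cmod c)\<^sup>2\<bar> \<le> 6 * \<epsilon>"
proof -
  have "continuous_on {0..1} (\<lambda>t. \<bar>y t\<bar>)"
    by (intro continuous_intros y_cont)
  then obtain t0 where t0: "t0 \<in> {0..1}" "\<And>t. t \<in> {0..1} \<Longrightarrow> \<bar>y t\<bar> \<le> \<bar>y t0\<bar>"
    using continuous_attains_sup[of "{0..1}" "\<lambda>t. \<bar>y t\<bar>"] by auto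
  define M where "M = \<bar>y t0\<bar>"
  have M: "\<bar>y t\<bar> \<le> M" if "t \<in> {0..1}" for t using t0(2)[OF that] by (simp add: M_def)
  have M0: "M \<ge> 0" by (simp add: M_def)
  have diff: "\<bar>y t - wave w c t\<bar> \<le> \<epsilon> * M" if "t \<in> {0..1}" for t
  proof -
    have "cmod (p t - p 0) / w \<le> \<epsilon> * w * M / w"
      using p_increment_le[OF that M] w_pos by (intro divide_right_mono) auto
    then show ?thesis using abs_y_minus_wave_le[of t] w_pos by simp
  qed
  have "M \<le> 2 * cmod c + \<epsilon> * M"
    using diff[OF t0(1)] abs_wave_le[of w c t0] unfolding M_def by linarith
  moreover have "\<epsilon> * M \<le> 1 / 50 * M" using small M0 by (rule mult_right_mono)
  ultimately have M_c: "M \<le> 41 / 20 * cmod c" using norm_ge_zero[of c] by linarith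
  have "((\<lambda>t. (y t)\<^sup>2 - wave w c t * wave w c t) has_integral (1 - 2 * Re (c * cnj c))) {0..1}"
    using y_norm has_integral_wave_mult_wave[OF n_pos w_def, of c c]
    by (intro has_integral_diff) (auto simp: has_integral_iff intro!: integrable_continuous_interval continuous_intros y_cont)
  then have "norm (1 - 2 * Re (c * cnj c)) \<le> (\<epsilon> * M * (M + 2 * cmod c)) * measure lborel {0..1::real}"
  proof (rule has_integral_bound_real[rotated 2])
    fix t :: real assume "t \<in> {0..1} - {}"
    then have t: "t \<in> {0..1}" by simp
    have "(y t)\<^sup>2 - wave w c t * wave w c t = (y t - wave w c t) * (y t + wave w c t)"
      by (simp add: algebra_simps power2_eq_square)
    moreover have "\<bar>y t + wave w c t\<bar> \<le> M + 2 * cmod c"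
      using M[OF t] abs_wave_le[of w c t] by linarith
    ultimately show "norm ((y t)\<^sup>2 - wave w c t * wave w c t) \<le> \<epsilon> * M * (M + 2 * cmod c)"
      using diff[OF t] \<epsilon>_nonneg M0 by (auto simp: abs_mult intro!: mult_mono)
  qed (use \<epsilon>_nonneg M0 in auto)
  moreover have "Re (c * cnj c) = (cmod c)\<^sup>2"
    by (simp add: complex_mult_cnj cmod_power2)
  ultimately have "\<bar>1 - 2 * (cmod c)\<^sup>2\<bar> \<le> \<epsilon> * M * (M + 2 * cmod c)" by simp
  also have "\<dots> \<le> \<epsilon> * (41 / 20 * cmod c) * (41 / 20 * cmod c + 2 * cmod c)"
    using M_c M0 \<epsilon>_nonneg by (intro mult_mono add_mono) auto
  also have "\<dots> \<le> \<epsilon> * (9 * (cmod c)\<^sup>2)"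
    using \<epsilon>_nonneg by (simp add: power2_eq_square algebra_simps)
  finally have c1: "\<bar>1 - 2 * (cmod c)\<^sup>2\<bar> \<le> \<epsilon> * (9 * (cmod c)\<^sup>2)" .
  have "\<epsilon> * (9 * (cmod c)\<^sup>2) \<le> 1 / 50 * (9 * (cmod c)\<^sup>2)"
    using small by (intro mult_right_mono) auto
  with c1 have c2: "(cmod c)\<^sup>2 \<le> 6 / 10" "43 / 100 \<le> (cmod c)\<^sup>2" "\<bar>1 - 2 * (cmod c)\<^sup>2\<bar> \<le> 1 / 50 * (9 * (cmod c)\<^sup>2)"
    by linarith+
  show c3: "cmod c \<le> 4 / 5" 
    by (rule power2_le_imp_le) (use c2 in \<open>auto simp: power2_eq_square\<close>)
  show "\<bar>y t\<bar> \<le> 2" if "t \<in> {0..1}" using M[OF that] M_c c3 by linarith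
  have "\<epsilon> * (9 * (cmod c)\<^sup>2) \<le> \<epsilon> * 6"
    using c2 \<epsilon>_nonneg by (intro mult_left_mono) auto
  with c1 show "\<bar>1 - 2 * (cmod c)\<^sup>2\<bar> \<le> 6 * \<epsilon>" by linarith
  with small have "44 / 100 \<le> (cmod c)\<^sup>2" by linarith
  then have "(33 / 50)\<^sup>2 \<le> (cmod c)\<^sup>2" by (simp add: power_divide)
  then show "33 / 50 \<le> cmod c" by (rule power2_le_imp_le) simp
qed

lemma y_minus_wave_le:
  assumes "t \<in> {0..1}"
  shows "\<bar>y t - wave w c t\<bar> \<le> 2 * \<epsilon>"
proof -
  have "cmod (p t - p 0) / w \<le> \<epsilon> * w * 2 / w"
    using p_increment_le[OF assms abs_y_le] w_pos by (intro divide_right_mono) auto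
  then show ?thesis using abs_y_minus_wave_le[of t] w_pos by simp
qed

lemma diff_wave_cont: "continuous_on {0..1} (\<lambda>t. (y t - wave w c t) *\<^sub>R cis (- (w * t)))"
  by (intro continuous_intros y_cont)

lemma u_minus_c_le: "cmod (u - c) \<le> 2 * \<epsilon>"
proof -
  have "((\<lambda>t. y t *\<^sub>R cis (- (w * t)) - wave w c t *\<^sub>R cis (- (w * t))) has_integral (u - c)) {0..1}"
    unfolding u_def
    by (intro has_integral_diff has_integral_wave_cis[OF n_pos w_def] integrable_integral integrable_continuous_interval yG_cont)
  then have "u - c = integral {0..1} (\<lambda>t. (y t - wave w c t) *\<^sub>R cis (- (w * t)))"
    by (simp add: integral_unique scaleR_left_diff_distrib)
  also have "cmod \<dots> \<le> 2 * \<epsilon> * (1 - 0)"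
    using y_minus_wave_le by (intro integral_bound diff_wave_cont) auto
  finally show ?thesis by simp
qed

lemma norm_u_bounds: "31 / 50 \<le> cmod u" "cmod u \<le> 21 / 25"
  using u_minus_c_le norm_c_le norm_c_ge small norm_triangle_ineq2[of c u] norm_triangle_ineq2[of u c]
  by (auto simp: norm_minus_commute)

lemma norm_u_sq: "\<bar>1 - 2 * (cmod u)\<^sup>2\<bar> \<le> 14 * \<epsilon>"
proof -
  have "\<bar>(cmod u)\<^sup>2 - (cmod c)\<^sup>2\<bar> = \<bar>cmod u - cmod c\<bar> * (cmod u + cmod c)"
    by (simp add: power2_eq_square square_diff_square_factored abs_mult mult.commute)
  also have "\<dots> \<le> (2 * \<epsilon>) * 2"
    using norm_triangle_ineq3[of u c] u_minus_c_le norm_u_bounds norm_c_le \<epsilon>_nonneg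
    by (intro mult_mono) auto
  finally show ?thesis using norm_c_sq by linarith
qed

text \<open>In \<open>d_u_eq\<close> the right side is at most \<open>2 K\<close>, and \<open>u\<close> is bounded below.  So an a priori bound on \<open>d\<close>
  by a small multiple of \<open>w\<close> improves to one independent of \<open>w\<close>, and \<open>\<epsilon>\<close> becomes of order \<open>1 / w\<close>.\<close>

lemma abs_d_le: "\<bar>d\<bar> \<le> 4 * K"
proof -
  have "cmod (d *\<^sub>R u) \<le> K * 2"
    unfolding d_u_eq K_def by (rule norm_integral_weighted_le[OF q_int yG_cont]) (auto simp: abs_y_le)
  moreover have "\<bar>d\<bar> * (31 / 50) \<le> \<bar>d\<bar> * cmod u"
    using norm_u_bounds by (intro mult_left_mono) auto
  ultimately have "\<bar>d\<bar> * (31 / 50) \<le> K * 2" by simp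
  then show ?thesis using K_nonneg by linarith
qed

lemma \<epsilon>_le: "\<epsilon> \<le> 5 * K / w"
  unfolding \<epsilon>_def using abs_d_le w_pos by (intro divide_right_mono) auto

lemma has_integral_q_scaleR:
  "continuous_on {0..1} G \<Longrightarrow> x \<in> {0..1} \<Longrightarrow>
    ((\<lambda>t. q t *\<^sub>R (G t :: complex)) has_integral (integral {0..x} (\<lambda>t. q t *\<^sub>R G t))) {0..x}"
  by (rule has_integral_weighted[OF q_int])

lemma integral_q_wave_cis:
  assumes "x \<in> {0..1}"
  shows "integral {0..x} (\<lambda>t. q t *\<^sub>R (wave w c t *\<^sub>R cis (- (w * t))))
     = integral {0..x} q *\<^sub>R c + cnj c * integral {0..x} (\<lambda>t. q t *\<^sub>R cis (- (2 * w * t)))"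
proof -
  have "(q has_integral integral {0..x} q) {0..x}"
    using has_integral_weighted[OF q_int continuous_on_const assms, of "1::real"] by simp
  then have "((\<lambda>t. q t *\<^sub>R c + cnj c * (q t *\<^sub>R cis (- (2 * w * t)))) has_integral
     integral {0..x} q *\<^sub>R c + cnj c * integral {0..x} (\<lambda>t. q t *\<^sub>R cis (- (2 * w * t)))) {0..x}"
    using assms by (intro has_integral_add has_integral_scaleR_left has_integral_mult_right has_integral_q_scaleR continuous_intros)
  then show ?thesis
    by (simp add: scaleR_wave_cis integral_unique scaleR_right_distrib mult_scaleR_right)
qed

lemma integral_q_y_cis:
  assumes x: "x \<in> {0..1}"
  shows "cmod (integral {0..x} (\<lambda>t. q t *\<^sub>R (y t *\<^sub>R cis (- (w * t))))
     - (integral {0..x} q *\<^sub>R c + cnj c * integral {0..x} (\<lambda>t. q t *\<^sub>R cis (- (2 * w * t))))) \<le> K * (2 * \<epsilon>)"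
proof -
  have "((\<lambda>t. q t *\<^sub>R (y t *\<^sub>R cis (- (w * t))) - q t *\<^sub>R (wave w c t *\<^sub>R cis (- (w * t)))) has_integral
     integral {0..x} (\<lambda>t. q t *\<^sub>R (y t *\<^sub>R cis (- (w * t))))
     - integral {0..x} (\<lambda>t. q t *\<^sub>R (wave w c t *\<^sub>R cis (- (w * t))))) {0..x}"
    using x by (intro has_integral_diff has_integral_q_scaleR continuous_intros y_cont)
  then have "integral {0..x} (\<lambda>t. q t *\<^sub>R (y t *\<^sub>R cis (- (w * t))))
     - integral {0..x} (\<lambda>t. q t *\<^sub>R (wave w c t *\<^sub>R cis (- (w * t))))
     = integral {0..x} (\<lambda>t. q t *\<^sub>R ((y t - wave w c t) *\<^sub>R cis (- (w * t))))"
    by (simp add: integral_unique scaleR_left_diff_distrib scaleR_right_diff_distrib)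
  moreover have "cmod (integral {0..x} (\<lambda>t. q t *\<^sub>R ((y t - wave w c t) *\<^sub>R cis (- (w * t))))) \<le> K * (2 * \<epsilon>)"
    unfolding K_def by (rule norm_integral_weighted_le[OF q_int diff_wave_cont x]) (simp add: y_minus_wave_le)
  ultimately show ?thesis unfolding integral_q_wave_cis[OF x] by (simp only:)
qed

section \<open>Second-order asymptotics and the size of the remainder\<close>

text \<open>
  The number \<open>r\<close> stands for a quantity that the Riemann-Lebesgue lemma makes arbitrarily small for large \<open>n\<close>.
\<close>

context
  fixes r :: real
  assumes r: "\<And>x. x \<in> {0..1} \<Longrightarrow> cmod (integral {0..x} (\<lambda>t. q t *\<^sub>R cis (- (2 * w * t)))) \<le> r"
begin

lemma r_nonneg: "r \<ge> 0" using order_trans[OF norm_ge_zero r[of 0]] by simp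

lemma \<kappa>_le: "cmod \<kappa> \<le> r" unfolding \<kappa>_def by (rule r) simp

text \<open>The mean of \<open>q\<close> is zero, so the leading term of \<open>d u\<close> is \<open>\<kappa>\<close> times a bounded factor, and \<open>d\<close> tends to zero.\<close>

lemma abs_d_le': "\<bar>d\<bar> \<le> 2 * r + 4 * K * \<epsilon>"
proof -
  have "cmod (d *\<^sub>R u - cnj c * \<kappa>) \<le> K * (2 * \<epsilon>)"
    using integral_q_y_cis[of 1] by (simp add: d_u_eq q_mean \<kappa>_def)
  moreover have "cmod (d *\<^sub>R u) \<le> cmod (d *\<^sub>R u - cnj c * \<kappa>) + cmod (cnj c * \<kappa>)"
    using norm_triangle_sub[of "d *\<^sub>R u" "cnj c * \<kappa>"] by simp
  moreover have "cmod (cnj c * \<kappa>) \<le> 4 / 5 * r"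
    unfolding norm_mult complex_mod_cnj using norm_c_le \<kappa>_le by (intro mult_mono) auto
  moreover have "\<bar>d\<bar> * (31 / 50) \<le> cmod (d *\<^sub>R u)"
    unfolding norm_scaleR using norm_u_bounds by (intro mult_left_mono) auto
  ultimately have "\<bar>d\<bar> * (31 / 50) \<le> 4 / 5 * r + K * \<epsilon> * 2" by linarith
  moreover have "K * \<epsilon> \<ge> 0" using K_nonneg \<epsilon>_nonneg by simp
  ultimately show ?thesis using r_nonneg by linarith
qed

text \<open>The error left in \<open>p\<close> after the explicit term of its first iteration, \<open>c\<close> times the primitive of \<open>q\<close>.\<close>

definition E where "E x = p x - p 0 - integral {0..x} q *\<^sub>R c"

lemma E_le:
  assumes x: "x \<in> {0..1}"
  shows "cmod (E x) \<le> 5 * r + 10 * K * \<epsilon>"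
proof -
  have E_eq: "E x = (integral {0..x} (\<lambda>t. q t *\<^sub>R (y t *\<^sub>R cis (- (w * t))))
     - (integral {0..x} q *\<^sub>R c + cnj c * integral {0..x} (\<lambda>t. q t *\<^sub>R cis (- (2 * w * t)))))
     + (cnj c * integral {0..x} (\<lambda>t. q t *\<^sub>R cis (- (2 * w * t)))
        - d *\<^sub>R integral {0..x} (\<lambda>t. y t *\<^sub>R cis (- (w * t))))"
    unfolding E_def p_eq[OF x] by simp
  have "cmod (E x) \<le> K * (2 * \<epsilon>) + (1 * r + (2 * r + 4 * K * \<epsilon>) * 2)"
    unfolding E_eq
  proof (rule order_trans[OF norm_triangle_ineq add_mono[OF integral_q_y_cis[OF x]]],
      rule order_trans[OF norm_triangle_ineq4 add_mono])
    show "cmod (cnj c * integral {0..x} (\<lambda>t. q t *\<^sub>R cis (- (2 * w * t)))) \<le> 1 * r"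
      unfolding norm_mult using norm_c_le r[OF x] by (intro mult_mono) auto
    have "cmod (integral {0..x} (\<lambda>t. y t *\<^sub>R cis (- (w * t)))) \<le> 2 * (x - 0)"
      using x abs_y_le by (intro integral_bound continuous_on_subset[OF yG_cont]) auto
    also have "\<dots> \<le> 2" using x by simp
    finally show "cmod (d *\<^sub>R integral {0..x} (\<lambda>t. y t *\<^sub>R cis (- (w * t)))) \<le> (2 * r + 4 * K * \<epsilon>) * 2"
      unfolding norm_scaleR using abs_d_le' by (intro mult_mono) auto
  qed
  then show ?thesis by (simp add: algebra_simps)
qed

lemma primitive_of_q_cont: "continuous_on {0..1} (\<lambda>x. integral {0..x} q)"
  using q_int by (intro indefinite_integral_continuous_1) (simp add: absolutely_integrable_on_def)

lemma E_cont: "continuous_on {0..1} E"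
  unfolding E_def p_def by (intro continuous_intros primitive_of_q_cont y_cont z_cont)

text \<open>The integral is half the square of the mean of \<open>q\<close>.\<close>

lemma integral_q_mult_primitive: "((\<lambda>t. q t * integral {0..t} q) has_integral 0) {0..1}"
proof -
  have "((\<lambda>t. q t *\<^sub>R integral {0..t} q + integral {0..t} q *\<^sub>R q t) has_integral
     integral {0..1} q *\<^sub>R integral {0..1} q - integral {0..0} q *\<^sub>R integral {0..0} q) {0..1}"
    by (rule absolutely_continuous_integration_by_parts[OF q_int q_int]) auto
  then have "((\<lambda>t. 2 * (q t * integral {0..t} q)) has_integral 0) {0..1}"
    by (simp add: q_mean mult.commute)
  from has_integral_mult_right[OF this, of "1/2"] show ?thesis by simp
qed

context
  assumes r': "cmod (integral {0..1} (\<lambda>t. (q t * integral {0..t} q) *\<^sub>R cis (- (2 * w * t)))) \<le> r"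
begin

text \<open>Inserting \<open>p = p 0 + Q c + E\<close> into \<open>y = Im (p exp (iwt)) / w\<close> and integrating against \<open>q exp (-iwt)\<close> leaves three
  terms.  The wave contributes \<open>\<kappa> cnj c\<close>, which differs from \<open>\<kappa> cnj u\<close> by \<open>O(\<epsilon> \<bar>\<kappa>\<bar>)\<close>.  The term with \<open>Q\<close>
  contributes, after division by \<open>w\<close>, the vanishing integral of \<open>q Q\<close> and the Fourier coefficient of \<open>q Q\<close> that is
  bounded by \<open>r\<close>.  The term with \<open>E\<close> is bounded by \<open>K\<close> times the maximum of \<open>\<bar>E\<bar>\<close>, again divided by \<open>w\<close>.\<close>

theorem remainder_le:
  "cmod (d *\<^sub>R u - \<kappa> * cnj u) \<le> ((1 + 15 * K) * r + 50 * K ^ 3 / w) / w"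
proof -
  define Q where "Q t = integral {0..t} q" for t
  define J where "J = integral {0..1} (\<lambda>t. (q t * Q t) *\<^sub>R cis (- (2 * w * t)))"
  define X where "X = integral {0..1} (\<lambda>t. q t *\<^sub>R (Im (E t * cis (w * t)) *\<^sub>R cis (- (w * t))))"
  have qQ: "(\<lambda>t. q t * Q t) absolutely_integrable_on {0..1}"
    using absolutely_integrable_scaleR_continuous[OF q_int primitive_of_q_cont] by (simp add: Q_def)
  have y_expand: "y t *\<^sub>R cis (- (w * t)) = wave w c t *\<^sub>R cis (- (w * t))
      + (1 / w) *\<^sub>R ((1 / (2 * \<i>)) * (Q t *\<^sub>R (c - cnj c * cis (- (2 * w * t)))))
      + (1 / w) *\<^sub>R (Im (E t * cis (w * t)) *\<^sub>R cis (- (w * t)))" for t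
  proof -
    have "p t - p 0 = Q t *\<^sub>R c + E t" by (simp add: E_def Q_def)
    then have "Im ((p t - p 0) * cis (w * t)) = Q t * Im (c * cis (w * t)) + Im (E t * cis (w * t))"
      by (simp add: algebra_simps)
    then have y_t: "y t = wave w c t + (1 / w) * (Q t * Im (c * cis (w * t))) + (1 / w) * Im (E t * cis (w * t))"
      using y_minus_wave[of t] by (simp only: add_divide_distrib) simp
    have im_cis: "Im (c * cis (w * t)) *\<^sub>R cis (- (w * t)) = (1 / (2 * \<i>)) * (c - cnj c * cis (- (2 * w * t)))"
    proof -
      have im: "(2 * \<i>) * complex_of_real (Im v) = v - cnj v" for v
        by (simp add: complex_eq_iff)
      have "(2 * \<i>) * (Im (c * cis (w * t)) *\<^sub>R cis (- (w * t)))
          = (c * cis (w * t) - cnj (c * cis (w * t))) * cis (- (w * t))"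
        unfolding im[symmetric] scaleR_conv_of_real by (simp only: mult.assoc)
      also have "\<dots> = c - cnj c * cis (- (2 * w * t))"
        by (simp add: left_diff_distrib cis_cnj mult.assoc cis_mult) (simp add: mult.commute)
      finally have "c - cnj c * cis (- (2 * w * t)) = (2 * \<i>) * (Im (c * cis (w * t)) *\<^sub>R cis (- (w * t)))" ..
      then show ?thesis by (simp only: mult.assoc[symmetric]) simp
    qed
    have "y t *\<^sub>R cis (- (w * t)) = wave w c t *\<^sub>R cis (- (w * t))
      + (1 / w) *\<^sub>R (Q t *\<^sub>R (Im (c * cis (w * t)) *\<^sub>R cis (- (w * t))))
      + (1 / w) *\<^sub>R (Im (E t * cis (w * t)) *\<^sub>R cis (- (w * t)))"
      by (simp only: y_t scaleR_left_distrib scaleR_scaleR mult.assoc)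
    then show ?thesis
      by (simp only: im_cis mult_scaleR_right)
  qed
  have "((\<lambda>t. q t *\<^sub>R (wave w c t *\<^sub>R cis (- (w * t)))
      + (1 / w) *\<^sub>R ((1 / (2 * \<i>)) * ((q t * Q t) *\<^sub>R c - cnj c * ((q t * Q t) *\<^sub>R cis (- (2 * w * t)))))
      + (1 / w) *\<^sub>R (q t *\<^sub>R (Im (E t * cis (w * t)) *\<^sub>R cis (- (w * t))))) has_integral
      cnj c * \<kappa> + (1 / w) *\<^sub>R ((1 / (2 * \<i>)) * (0 *\<^sub>R c - cnj c * J)) + (1 / w) *\<^sub>R X) {0..1}"
  proof (intro has_integral_add has_integral_cmul has_integral_mult_right has_integral_diff has_integral_scaleR_left)
    have "continuous_on {0..1} (\<lambda>t. wave w c t *\<^sub>R cis (- (w * t)))"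
      by (intro continuous_intros)
    from has_integral_q_scaleR[OF this, of 1]
    show "((\<lambda>t. q t *\<^sub>R (wave w c t *\<^sub>R cis (- (w * t)))) has_integral cnj c * \<kappa>) {0..1}"
      by (simp add: integral_q_wave_cis q_mean \<kappa>_def del: scaleR_scaleR)
    show "((\<lambda>t. q t * Q t) has_integral 0) {0..1}"
      using integral_q_mult_primitive by (simp add: Q_def)
    show "((\<lambda>t. (q t * Q t) *\<^sub>R cis (- (2 * w * t))) has_integral J) {0..1}"
      unfolding J_def by (rule has_integral_weighted[OF qQ]) (auto intro!: continuous_intros)
    show "((\<lambda>t. q t *\<^sub>R (Im (E t * cis (w * t)) *\<^sub>R cis (- (w * t)))) has_integral X) {0..1}"
      unfolding X_def by (rule has_integral_q_scaleR) (auto intro!: continuous_intros E_cont)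
  qed
  then have "d *\<^sub>R u = cnj c * \<kappa> + (1 / w) *\<^sub>R ((1 / (2 * \<i>)) * (0 *\<^sub>R c - cnj c * J)) + (1 / w) *\<^sub>R X"
    unfolding d_u_eq y_expand
    by (intro integral_unique) (simp add: scaleR_conv_of_real algebra_simps)
  then have "d *\<^sub>R u - \<kappa> * cnj u = \<kappa> * cnj (c - u) + (1 / w) *\<^sub>R (X - (1 / (2 * \<i>)) * (cnj c * J))"
    by (simp add: algebra_simps)
  also have "cmod \<dots> \<le> r * (2 * \<epsilon>) + (1 / w) * (K * (5 * r + 10 * K * \<epsilon>) + r)"
  proof (intro order_trans[OF norm_triangle_ineq] add_mono)
    show "cmod (\<kappa> * cnj (c - u)) \<le> r * (2 * \<epsilon>)"
      unfolding norm_mult complex_mod_cnj using u_minus_c_le \<kappa>_le r_nonneg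
      by (intro mult_mono) (auto simp: norm_minus_commute)
    have "cmod X \<le> K * (5 * r + 10 * K * \<epsilon>)"
      unfolding X_def K_def
    proof (rule norm_integral_weighted_le[OF q_int])
      fix t :: real assume "t \<in> {0..1}"
      have "cmod (Im (E t * cis (w * t)) *\<^sub>R cis (- (w * t))) \<le> cmod (E t)"
        using abs_Im_le_cmod[of "E t * cis (w * t)"] by (simp add: norm_mult)
      then show "cmod (Im (E t * cis (w * t)) *\<^sub>R cis (- (w * t))) \<le> 5 * r + 10 * integral {0..1} (\<lambda>t. \<bar>q t\<bar>) * \<epsilon>"
        using E_le[OF \<open>t \<in> {0..1}\<close>] by (simp add: K_def)
    qed (auto intro!: continuous_intros E_cont)
    moreover have "cmod ((1 / (2 * \<i>)) * (cnj c * J)) \<le> r"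
    proof -
      have "cmod c * cmod J \<le> 1 * r"
        using norm_c_le r' by (intro mult_mono) (auto simp: J_def Q_def)
      then show ?thesis using r_nonneg by (simp add: norm_mult norm_divide)
    qed
    ultimately have "cmod (X - (1 / (2 * \<i>)) * (cnj c * J)) \<le> K * (5 * r + 10 * K * \<epsilon>) + r"
      by (intro order_trans[OF norm_triangle_ineq4] add_mono)
    then show "cmod ((1 / w) *\<^sub>R (X - (1 / (2 * \<i>)) * (cnj c * J))) \<le> (1 / w) * (K * (5 * r + 10 * K * \<epsilon>) + r)"
      using w_pos by (simp add: divide_right_mono)
  qed
  also have "\<dots> \<le> r * (2 * (5 * K / w)) + (1 / w) * (K * (5 * r + 10 * K * (5 * K / w)) + r)"
    using \<epsilon>_le r_nonneg K_nonneg w_pos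
    by (intro add_mono mult_left_mono) auto
  also have "\<dots> = ((1 + 15 * K) * r + 50 * K ^ 3 / w) / w"
    using w_pos by (simp add: field_simps power3_eq_cube)
  finally show ?thesis .
qed

end
end
end
end

section \<open>The two eigenvalues of one index\<close>

text \<open>The inner product of the waves with amplitudes \<open>c1\<close> and \<open>c2\<close> is \<open>2 Re (c1 cnj c2)\<close>; the waves are close to the
  eigenfunctions and the amplitudes close to the coefficients \<open>u\<close>.\<close>

lemma orthogonal_pair_coefficients:
  assumes "normalized_periodic_solution q l1 y1 z1 n" "normalized_periodic_solution q l2 y2 z2 n"
    and orth: "integral {0..1} (\<lambda>t. y1 t * y2 t) = 0"
    and small: "normalized_periodic_solution.\<epsilon> q l1 n \<le> e" "normalized_periodic_solution.\<epsilon> q l2 n \<le> e" "e \<le> 1 / 50"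
  shows "\<bar>Re (normalized_periodic_solution.u y1 n * cnj (normalized_periodic_solution.u y2 n))\<bar> \<le> 8 * e"
proof -
  interpret A: normalized_periodic_solution q l1 y1 z1 n by fact
  interpret B: normalized_periodic_solution q l2 y2 z2 n by fact
  have sA: "A.\<epsilon> \<le> 1 / 50" and sB: "B.\<epsilon> \<le> 1 / 50" using small by auto
  have e0: "0 \<le> e" using A.\<epsilon>_nonneg small by linarith
  note cA = A.coarse_asymptotics[OF sA] and cB = B.coarse_asymptotics[OF sB]
  have "((\<lambda>t. wave A.w A.c t * wave A.w B.c t - y1 t * y2 t) has_integral (2 * Re (A.c * cnj B.c) - 0)) {0..1}"
  proof (rule has_integral_diff[OF has_integral_wave_mult_wave[OF A.n_pos A.w_def]])
    show "((\<lambda>t. y1 t * y2 t) has_integral 0) {0..1}"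
      using orth by (auto simp: has_integral_iff intro!: integrable_continuous_interval continuous_intros A.y_cont B.y_cont)
  qed
  then have "norm (2 * Re (A.c * cnj B.c) - 0) \<le> 8 * e * measure lborel {0..1::real}"
  proof (rule has_integral_bound_real[rotated 2])
    fix t :: real assume "t \<in> {0..1} - {}"
    then have t: "t \<in> {0..1}" by simp
    have split: "wave A.w A.c t * wave A.w B.c t - y1 t * y2 t
      = (wave A.w A.c t - y1 t) * wave A.w B.c t + y1 t * (wave A.w B.c t - y2 t)"
      by (simp add: algebra_simps)
    have "norm (wave A.w A.c t * wave A.w B.c t - y1 t * y2 t) \<le> \<bar>wave A.w A.c t - y1 t\<bar> * \<bar>wave A.w B.c t\<bar> + \<bar>y1 t\<bar> * \<bar>wave A.w B.c t - y2 t\<bar>"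
      unfolding split real_norm_def by (rule order_trans[OF abs_triangle_ineq]) (simp add: abs_mult)
    also have "\<dots> \<le> (2 * e) * 2 + 2 * (2 * e)"
    proof (intro add_mono mult_mono)
      show "\<bar>wave A.w A.c t - y1 t\<bar> \<le> 2 * e"
        using A.y_minus_wave_le[OF sA t] small by linarith
      show "\<bar>wave A.w B.c t - y2 t\<bar> \<le> 2 * e"
        using B.y_minus_wave_le[OF sB t] small by linarith
      show "\<bar>wave A.w B.c t\<bar> \<le> 2"
        using abs_wave_le[of A.w B.c t] cB(2) by linarith
    qed (use cA(1)[OF t] e0 in auto)
    finally show "norm (wave A.w A.c t * wave A.w B.c t - y1 t * y2 t) \<le> 8 * e" by simp
  qed (use e0 in auto)
  then have 1: "\<bar>Re (A.c * cnj B.c)\<bar> \<le> 4 * e" by simp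
  have "A.u * cnj B.u - A.c * cnj B.c = (A.u - A.c) * cnj B.u + A.c * cnj (B.u - B.c)"
    by (simp add: algebra_simps)
  also have "cmod \<dots> \<le> (2 * e) * 1 + 1 * (2 * e)"
    using A.u_minus_c_le[OF sA] B.u_minus_c_le[OF sB] small A.norm_u_bounds[OF sA] B.norm_u_bounds[OF sB] cA(2) e0
    by (intro order_trans[OF norm_triangle_ineq] add_mono; unfold norm_mult complex_mod_cnj; intro mult_mono) auto
  finally have "\<bar>Re (A.u * cnj B.u - A.c * cnj B.c)\<bar> \<le> 4 * e"
    using abs_Re_le_cmod order_trans by fastforce
  with 1 show ?thesis by simp
qed

lemma cmod_sum_squares:
  "(cmod (a\<^sup>2 + b\<^sup>2))\<^sup>2 = ((cmod a)\<^sup>2 - (cmod b)\<^sup>2)\<^sup>2 + 4 * (Re (a * cnj b))\<^sup>2"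
proof -
  have "(cmod (a\<^sup>2 + b\<^sup>2))\<^sup>2 = (Re (a\<^sup>2 + b\<^sup>2))\<^sup>2 + (Im (a\<^sup>2 + b\<^sup>2))\<^sup>2"
    by (rule cmod_power2)
  then show ?thesis
    by (simp add: cmod_power2 power2_eq_square[of a] power2_eq_square[of b]) algebra
qed

text \<open>
  What remains for a single \<open>n\<close> is algebra with two relations \<open>\<delta> u = \<kappa> cnj u + \<alpha>\<close>, whose coefficients satisfy
  \<open>\<bar>u\<bar>\<^sup>2 = 1/2\<close> and are orthogonal as vectors of the real plane, both up to a small error.
\<close>

context
  fixes \<delta>1 \<delta>2 :: real and \<kappa> u1 u2 \<alpha>1 \<alpha>2 :: complex
  assumes le: "\<delta>1 \<le> \<delta>2"
    and eq1: "of_real \<delta>1 * u1 = \<kappa> * cnj u1 + \<alpha>1"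
    and eq2: "of_real \<delta>2 * u2 = \<kappa> * cnj u2 + \<alpha>2"
    and u1: "\<bar>1 - 2 * (cmod u1)\<^sup>2\<bar> \<le> 1 / 100"
    and u2: "\<bar>1 - 2 * (cmod u2)\<^sup>2\<bar> \<le> 1 / 100"
    and orth: "\<bar>Re (u1 * cnj u2)\<bar> \<le> 1 / 100"
begin

private lemma norm_u: "cmod u1 \<le> 3 / 4" "7 / 10 \<le> cmod u1" "cmod u2 \<le> 3 / 4" "7 / 10 \<le> cmod u2"
proof -
  have "cmod u \<le> 3 / 4 \<and> 7 / 10 \<le> cmod u" if "\<bar>1 - 2 * (cmod u)\<^sup>2\<bar> \<le> 1 / 100" for u
  proof
    have "(cmod u)\<^sup>2 \<le> (3 / 4)\<^sup>2" "(7 / 10)\<^sup>2 \<le> (cmod u)\<^sup>2"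
      using that unfolding power_divide abs_le_iff by auto
    then show "cmod u \<le> 3 / 4" "7 / 10 \<le> cmod u"
      by (auto intro: power2_le_imp_le)
  qed
  then show "cmod u1 \<le> 3 / 4" "7 / 10 \<le> cmod u1" "cmod u2 \<le> 3 / 4" "7 / 10 \<le> cmod u2"
    using u1 u2 by auto
qed

text \<open>Orthogonal plane vectors of equal length differ by a factor \<open>\<i>\<close> or \<open>- \<i>\<close>, so their squares are opposite;
  \<open>cmod_sum_squares\<close> makes this quantitative.\<close>

private lemma squares_cancel: "cmod ((cnj u1)\<^sup>2 + (cnj u2)\<^sup>2) \<le> 3 / 100"
proof -
  have "\<bar>(cmod u1)\<^sup>2 - (cmod u2)\<^sup>2\<bar> \<le> 1 / 100" using u1 u2 by linarith
  then have "((cmod u1)\<^sup>2 - (cmod u2)\<^sup>2)\<^sup>2 \<le> (1 / 100)\<^sup>2"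
    by (rule abs_le_square_iff[THEN iffD1, of _ "1/100::real", simplified abs_of_nonneg, rotated -1]) 
  moreover have "(Re (u1 * cnj u2))\<^sup>2 \<le> (1 / 100)\<^sup>2"
    using orth by (metis abs_ge_zero power2_abs power_mono)
  ultimately have "(cmod (u1\<^sup>2 + u2\<^sup>2))\<^sup>2 \<le> (3 / 100)\<^sup>2"
    unfolding cmod_sum_squares by (simp add: power_divide)
  then have "cmod (u1\<^sup>2 + u2\<^sup>2) \<le> 3 / 100" by (rule power2_le_imp_le) simp
  then show ?thesis by (metis complex_cnj_add complex_cnj_power complex_mod_cnj)
qed

private lemma abs_\<delta>_close:
  "\<bar>\<bar>\<delta>1\<bar> - cmod \<kappa>\<bar> * cmod u1 \<le> cmod \<alpha>1" "\<bar>\<bar>\<delta>2\<bar> - cmod \<kappa>\<bar> * cmod u2 \<le> cmod \<alpha>2"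
proof -
  have "\<bar>\<bar>\<delta>\<bar> - cmod \<kappa>\<bar> * cmod u \<le> cmod \<alpha>" if "of_real \<delta> * u = \<kappa> * cnj u + \<alpha>" for \<delta> u \<alpha>
  proof -
    have "\<bar>\<bar>\<delta>\<bar> - cmod \<kappa>\<bar> * cmod u = \<bar>cmod (of_real \<delta> * u) - cmod (\<kappa> * cnj u)\<bar>"
      by (simp add: norm_mult abs_mult flip: left_diff_distrib)
    also have "\<dots> \<le> cmod (of_real \<delta> * u - \<kappa> * cnj u)" by (rule norm_triangle_ineq3)
    also have "of_real \<delta> * u - \<kappa> * cnj u = \<alpha>" using that by simp
    finally show ?thesis .
  qed
  then show "\<bar>\<bar>\<delta>1\<bar> - cmod \<kappa>\<bar> * cmod u1 \<le> cmod \<alpha>1" "\<bar>\<bar>\<delta>2\<bar> - cmod \<kappa>\<bar> * cmod u2 \<le> cmod \<alpha>2"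
    using eq1 eq2 by auto
qed

private lemma abs_\<delta>_close':
  "\<bar>\<bar>\<delta>1\<bar> - cmod \<kappa>\<bar> * (7 / 10) \<le> cmod \<alpha>1" "\<bar>\<bar>\<delta>2\<bar> - cmod \<kappa>\<bar> * (7 / 10) \<le> cmod \<alpha>2"
proof -
  have "\<bar>\<bar>\<delta>1\<bar> - cmod \<kappa>\<bar> * (7 / 10) \<le> \<bar>\<bar>\<delta>1\<bar> - cmod \<kappa>\<bar> * cmod u1"
    "\<bar>\<bar>\<delta>2\<bar> - cmod \<kappa>\<bar> * (7 / 10) \<le> \<bar>\<bar>\<delta>2\<bar> - cmod \<kappa>\<bar> * cmod u2"
    by (intro mult_left_mono norm_u; simp)+
  with abs_\<delta>_close show
    "\<bar>\<bar>\<delta>1\<bar> - cmod \<kappa>\<bar> * (7 / 10) \<le> cmod \<alpha>1" "\<bar>\<bar>\<delta>2\<bar> - cmod \<kappa>\<bar> * (7 / 10) \<le> cmod \<alpha>2"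
    by linarith+
qed

text \<open>Multiplying each relation by \<open>cnj u\<close> and adding, \<open>\<kappa>\<close> acquires the factor that \<open>squares_cancel\<close> makes small.\<close>

private lemma weighted_trace:
  "\<bar>\<delta>1 * (cmod u1)\<^sup>2 + \<delta>2 * (cmod u2)\<^sup>2\<bar> \<le> 3 / 100 * cmod \<kappa> + 3 / 4 * cmod \<alpha>1 + 3 / 4 * cmod \<alpha>2"
proof -
  have "complex_of_real (\<delta>1 * (cmod u1)\<^sup>2 + \<delta>2 * (cmod u2)\<^sup>2)
     = (of_real \<delta>1 * u1) * cnj u1 + (of_real \<delta>2 * u2) * cnj u2"
    by (simp add: mult.assoc complex_norm_square[symmetric])
  also have "\<dots> = \<kappa> * ((cnj u1)\<^sup>2 + (cnj u2)\<^sup>2) + (\<alpha>1 * cnj u1 + \<alpha>2 * cnj u2)"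
    unfolding eq1 eq2 by (simp add: algebra_simps power2_eq_square)
  finally have "\<bar>\<delta>1 * (cmod u1)\<^sup>2 + \<delta>2 * (cmod u2)\<^sup>2\<bar>
     = cmod (\<kappa> * ((cnj u1)\<^sup>2 + (cnj u2)\<^sup>2) + (\<alpha>1 * cnj u1 + \<alpha>2 * cnj u2))"
    by (metis norm_of_real)
  also have "\<dots> \<le> cmod \<kappa> * (3 / 100) + (cmod \<alpha>1 * (3 / 4) + cmod \<alpha>2 * (3 / 4))"
    by (intro order_trans[OF norm_triangle_ineq] add_mono; simp only: norm_mult complex_mod_cnj)
       (intro mult_left_mono squares_cancel norm_u norm_ge_zero)+
  also have "\<dots> = 3 / 100 * cmod \<kappa> + 3 / 4 * cmod \<alpha>1 + 3 / 4 * cmod \<alpha>2"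
    by (simp add: field_simps)
  finally show ?thesis .
qed

text \<open>If \<open>\<delta>1\<close> and \<open>\<delta>2\<close> have opposite signs, each is determined by its absolute value.  If they have the same sign, there is no
  cancellation in \<open>weighted_trace\<close>, so \<open>\<bar>\<kappa>\<bar>\<close> is at most a multiple of the remainders, and both claims hold
  because every quantity in them is that small.\<close>

lemma splitting_estimates:
  "\<bar>\<delta>1 + cmod \<kappa>\<bar> \<le> 14 * (cmod \<alpha>1 + cmod \<alpha>2)" "\<bar>\<delta>2 - cmod \<kappa>\<bar> \<le> 14 * (cmod \<alpha>1 + cmod \<alpha>2)"
proof -
  define t1 t2 where "t1 = \<bar>\<bar>\<delta>1\<bar> - cmod \<kappa>\<bar>" and "t2 = \<bar>\<bar>\<delta>2\<bar> - cmod \<kappa>\<bar>"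
  have c: "t1 * (7 / 10) \<le> cmod \<alpha>1" "t2 * (7 / 10) \<le> cmod \<alpha>2"
    using abs_\<delta>_close' by (auto simp: t1_def t2_def)
  have t: "\<bar>\<delta>1\<bar> - cmod \<kappa> \<le> t1" "cmod \<kappa> - \<bar>\<delta>1\<bar> \<le> t1" "\<bar>\<delta>2\<bar> - cmod \<kappa> \<le> t2" "cmod \<kappa> - \<bar>\<delta>2\<bar> \<le> t2"
    unfolding t1_def t2_def by linarith+
  have p: "\<bar>\<delta>1\<bar> * (49 / 100) \<le> \<bar>\<delta>1\<bar> * (cmod u1)\<^sup>2" "\<bar>\<delta>2\<bar> * (49 / 100) \<le> \<bar>\<delta>2\<bar> * (cmod u2)\<^sup>2"
    using u1 u2 by (intro mult_left_mono; linarith)+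
  have "\<bar>\<delta>1 + cmod \<kappa>\<bar> \<le> 14 * (cmod \<alpha>1 + cmod \<alpha>2) \<and> \<bar>\<delta>2 - cmod \<kappa>\<bar> \<le> 14 * (cmod \<alpha>1 + cmod \<alpha>2)"
  proof (cases "\<delta>1 \<le> 0 \<and> 0 \<le> \<delta>2")
    case True
    then have "\<bar>\<delta>1 + cmod \<kappa>\<bar> = t1" "\<bar>\<delta>2 - cmod \<kappa>\<bar> = t2" unfolding t1_def t2_def by linarith+
    then show ?thesis using c norm_ge_zero[of \<alpha>1] norm_ge_zero[of \<alpha>2]
      unfolding distrib_left by (intro conjI) linarith+
  next
    case False
    then have s: "\<delta>1 > 0 \<and> \<delta>2 > 0 \<or> \<delta>1 < 0 \<and> \<delta>2 < 0" using le by linarith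
    have "\<bar>\<delta>1 * (cmod u1)\<^sup>2 + \<delta>2 * (cmod u2)\<^sup>2\<bar> = \<bar>\<delta>1\<bar> * (cmod u1)\<^sup>2 + \<bar>\<delta>2\<bar> * (cmod u2)\<^sup>2"
    proof (cases "\<delta>1 > 0")
      case True
      then show ?thesis using s by (auto intro!: abs_of_nonneg)
    next
      case False
      then have "\<delta>1 * (cmod u1)\<^sup>2 + \<delta>2 * (cmod u2)\<^sup>2 \<le> 0"
        using s by (intro add_nonpos_nonpos mult_nonpos_nonneg) auto
      then show ?thesis using s False by simp
    qed
    then have "\<bar>\<delta>1\<bar> * (49 / 100) + \<bar>\<delta>2\<bar> * (49 / 100) \<le> 3 / 100 * cmod \<kappa> + 3 / 4 * cmod \<alpha>1 + 3 / 4 * cmod \<alpha>2"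
      using weighted_trace p by linarith
    then have "cmod \<kappa> \<le> 2 * cmod \<alpha>1 + 2 * cmod \<alpha>2"
      using c t norm_ge_zero[of \<alpha>1] norm_ge_zero[of \<alpha>2] by linarith
    moreover have "\<bar>\<delta>1 + cmod \<kappa>\<bar> \<le> \<bar>\<delta>1\<bar> + cmod \<kappa>" "\<bar>\<delta>2 - cmod \<kappa>\<bar> \<le> \<bar>\<delta>2\<bar> + cmod \<kappa>"
      using norm_ge_zero[of \<kappa>] by linarith+
    ultimately show ?thesis
      using c t norm_ge_zero[of \<alpha>1] norm_ge_zero[of \<alpha>2]
      unfolding distrib_left by (intro conjI) linarith+
  qed
  then show "\<bar>\<delta>1 + cmod \<kappa>\<bar> \<le> 14 * (cmod \<alpha>1 + cmod \<alpha>2)" "\<bar>\<delta>2 - cmod \<kappa>\<bar> \<le> 14 * (cmod \<alpha>1 + cmod \<alpha>2)"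
    by auto
qed

text \<open>For a double value, \<open>weighted_trace\<close> bounds \<open>\<bar>\<delta>1\<bar>\<close> by about \<open>1 / \<surd>2\<close> times the sum of the remainders, and
  averaging \<open>abs_\<delta>_close'\<close> bounds \<open>\<bar>\<kappa>\<bar> - \<bar>\<delta>1\<bar>\<close> in the same way.  So \<open>\<bar>\<kappa>\<bar>\<close> would be at most about \<open>\<surd>2\<close>
  times that sum, and \<open>\<surd>2 < 2\<close>.\<close>

lemma splitting_strict:
  assumes "\<kappa> \<noteq> 0" and dom: "2 * (cmod \<alpha>1 + cmod \<alpha>2) \<le> cmod \<kappa>"
  shows "\<delta>1 < \<delta>2"
proof (rule ccontr)
  assume "\<not> \<delta>1 < \<delta>2"
  then have eq: "\<delta>2 = \<delta>1" using le by simp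
  have "\<bar>\<delta>1\<bar> * (49 / 100 + 49 / 100) \<le> \<bar>\<delta>1\<bar> * ((cmod u1)\<^sup>2 + (cmod u2)\<^sup>2)"
    using u1 u2 by (intro mult_left_mono; linarith)
  also have "\<dots> = \<bar>\<delta>1 * (cmod u1)\<^sup>2 + \<delta>2 * (cmod u2)\<^sup>2\<bar>"
    by (simp add: eq abs_mult flip: distrib_left)
  also note weighted_trace
  finally have "\<bar>\<delta>1\<bar> * (98 / 100) \<le> 3 / 100 * cmod \<kappa> + 3 / 4 * cmod \<alpha>1 + 3 / 4 * cmod \<alpha>2" by simp
  moreover have "cmod \<kappa> * (7 / 10) - \<bar>\<delta>1\<bar> * (7 / 10) \<le> cmod \<alpha>1" "cmod \<kappa> * (7 / 10) - \<bar>\<delta>1\<bar> * (7 / 10) \<le> cmod \<alpha>2"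
  proof -
    have "cmod \<kappa> * (7 / 10) - \<bar>\<delta>1\<bar> * (7 / 10) \<le> \<bar>\<bar>\<delta>1\<bar> - cmod \<kappa>\<bar> * (7 / 10)"
      unfolding left_diff_distrib[symmetric] by (rule mult_right_mono) auto
    then show "cmod \<kappa> * (7 / 10) - \<bar>\<delta>1\<bar> * (7 / 10) \<le> cmod \<alpha>1" "cmod \<kappa> * (7 / 10) - \<bar>\<delta>1\<bar> * (7 / 10) \<le> cmod \<alpha>2"
      using abs_\<delta>_close'[unfolded eq] by (blast intro: order_trans)+
  qed
  moreover have "2 * cmod \<alpha>1 + 2 * cmod \<alpha>2 \<le> cmod \<kappa>" using dom by simp
  ultimately have "cmod \<kappa> \<le> 0" by linarith
  with assms(1) show False by simp
qed

end

section \<open>From the operator to periodic solutions\<close>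

lemma ip01_expi2pi:
  fixes f :: "real \<Rightarrow> real"
  assumes "f absolutely_integrable_on {0..1}"
  shows "ip01 (\<lambda>x. of_real (f x)) (expi2pi k)
    = integral {0..1} (\<lambda>t. f t *\<^sub>R cis (- (2 * pi * of_int k * t)))"
proof -
  have "of_real (f x) * cnj (expi2pi k x) = f x *\<^sub>R cis (- (2 * pi * of_int k * x))" for x
  proof -
    have "expi2pi k x = cis (2 * pi * of_int k * x)"
      by (simp add: expi2pi_def cis_conv_exp mult_ac)
    then show ?thesis by (simp add: cis_cnj scaleR_conv_of_real)
  qed
  moreover have "(\<lambda>t. f t *\<^sub>R cis (- (2 * pi * of_int k * t))) absolutely_integrable_on {0..1}"
    by (intro absolutely_integrable_scaleR_continuous[OF assms] continuous_intros)
  ultimately show ?thesis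
    by (simp add: ip01_def set_lebesgue_integral_eq_integral(2))
qed

text \<open>Since the eigenvalue and the eigenfunction are real, the real part of the derivative supplied by the operator is the derivative
  of the eigenfunction, and the almost everywhere equation determines the real part of the second derivative up to a null set.\<close>

lemma eigenfunction_imp_periodic_solution:
  assumes q: "q absolutely_integrable_on {0..1}"
    and eig: "L0_eigenfunction q (of_real l) (\<lambda>x. of_real (y x))"
  shows "\<exists>z. periodic_solution q l y z"
proof -
  obtain y' y'' where "(\<forall>x\<in>{0..1}. ((\<lambda>x. complex_of_real (y x)) has_vector_derivative y' x) (at x within {0..1})) \<and>
        y'' absolutely_integrable_on {0..1} \<and>
        (\<forall>x\<in>{0..1}. y' x = y' 0 + (LINT t:{0..x}|lebesgue. y'' t)) \<and>
        complex_of_real (y 1) = complex_of_real (y 0) \<and> y' 1 = y' 0 \<and>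
        (AE x in lebesgue. x \<in> {0..1} \<longrightarrow>
          of_real l * complex_of_real (y x) = - y'' x + of_real (q x) * complex_of_real (y x))"
    using eig unfolding L0_eigenfunction_def L0_maps_def by blast
  then have d: "\<And>x. x \<in> {0..1} \<Longrightarrow> ((\<lambda>x. complex_of_real (y x)) has_vector_derivative y' x) (at x within {0..1})"
    and int: "y'' absolutely_integrable_on {0..1}"
    and y': "\<And>x. x \<in> {0..1} \<Longrightarrow> y' x = y' 0 + (LINT t:{0..x}|lebesgue. y'' t)"
    and per: "complex_of_real (y 1) = complex_of_real (y 0)" "y' 1 = y' 0"
    and ae: "AE x in lebesgue. x \<in> {0..1} \<longrightarrow> of_real l * complex_of_real (y x) = - y'' x + of_real (q x) * complex_of_real (y x)"
    by blast+
  obtain N where N: "negligible N" "\<And>x. x \<notin> N \<Longrightarrow> x \<in> {0..1} \<Longrightarrow>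
      of_real l * complex_of_real (y x) = - y'' x + of_real (q x) * complex_of_real (y x)"
    using ae by (auto simp: eventually_ae_filter negligible_iff_null_sets)
  have re: "Re (y'' x) = (q x - l) * y x" if "x \<notin> N" "x \<in> {0..1}" for x
  proof -
    have "Re (of_real l * complex_of_real (y x)) = Re (- y'' x + of_real (q x) * complex_of_real (y x))"
      using N(2)[OF that] by simp
    then show ?thesis by (simp add: algebra_simps)
  qed
  have "periodic_solution q l y (\<lambda>x. Re (y' x))"
  proof
    show "q absolutely_integrable_on {0..1}" by fact
    show "(y has_real_derivative Re (y' x)) (at x within {0..1})" if "x \<in> {0..1}" for x
      using bounded_linear.has_vector_derivative[OF bounded_linear_Re d[OF that]]
      by (simp add: has_real_derivative_iff_has_vector_derivative)
    show "Re (y' x) = Re (y' 0) + integral {0..x} (\<lambda>t. (q t - l) * y t)" if x: "x \<in> {0..1}" for x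
    proof -
      have ix: "y'' absolutely_integrable_on {0..x}"
        using absolutely_integrable_subinterval[OF int] x by simp
      have "(LINT t:{0..x}|lebesgue. y'' t) = integral {0..x} y''"
        by (rule set_lebesgue_integral_eq_integral(2)[OF ix])
      moreover have "Re (integral {0..x} y'') = integral {0..x} (\<lambda>t. Re (y'' t))"
        using integral_linear[OF _ bounded_linear_Re, of y'' "{0..x}"] ix
        by (simp add: absolutely_integrable_on_def o_def)
      moreover have "integral {0..x} (\<lambda>t. Re (y'' t)) = integral {0..x} (\<lambda>t. (q t - l) * y t)"
        using x by (intro integral_spike[OF N(1)]) (auto simp: re)
      ultimately show ?thesis using y'[OF x] by simp
    qed
  qed (use per in auto)
  then show ?thesis by blast
qed

lemma norm01_of_real:
  assumes "continuous_on {0..1} y"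
  shows "norm01 (\<lambda>x. of_real (y x)) = sqrt (integral {0..1} (\<lambda>t. (y t)\<^sup>2))"
proof -
  have "(\<lambda>t. (y t)\<^sup>2) absolutely_integrable_on {0..1}"
    by (intro absolutely_integrable_continuous_real continuous_intros assms)
  then show ?thesis
    by (simp add: norm01_def set_lebesgue_integral_eq_integral(2))
qed

lemma ip01_of_real:
  assumes "continuous_on {0..1} y1" "continuous_on {0..1} y2"
  shows "ip01 (\<lambda>x. of_real (y1 x)) (\<lambda>x. of_real (y2 x)) = of_real (integral {0..1} (\<lambda>t. y1 t * y2 t))"
proof -
  have c: "continuous_on {0..1} (\<lambda>t. y1 t * y2 t)" by (intro continuous_intros assms)
  have "(\<lambda>t. complex_of_real (y1 t * y2 t)) absolutely_integrable_on {0..1}"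
    by (intro absolutely_integrable_continuous_real continuous_intros assms)
  then have "ip01 (\<lambda>x. of_real (y1 x)) (\<lambda>x. of_real (y2 x)) = integral {0..1} (\<lambda>t. complex_of_real (y1 t * y2 t))"
    by (simp add: ip01_def set_lebesgue_integral_eq_integral(2))
  also have "\<dots> = of_real (integral {0..1} (\<lambda>t. y1 t * y2 t))"
    using integral_linear[OF integrable_continuous_interval[OF c] bounded_linear_of_real]
    by (simp add: o_def)
  finally show ?thesis .
qed

section \<open>Asymptotics along the eigenvalue sequences\<close>

lemma eventually_\<epsilon>_le:
  assumes lam: "(\<lambda>n. lam n - (2 * pi * real n)\<^sup>2) \<in> O(\<lambda>n. real n powr (1/2))" and e: "e > 0"
  shows "\<forall>\<^sub>F n in sequentially. (K + \<bar>lam n - (2 * pi * real n)\<^sup>2\<bar>) / (2 * pi * real n) \<le> e"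
proof -
  obtain C where C: "\<forall>\<^sub>F n in sequentially. norm (lam n - (2 * pi * real n)\<^sup>2) \<le> C * norm (real n powr (1/2))"
    using landau_o.bigE[OF lam] by blast
  have "(\<lambda>n. K / (2 * pi) / real n + C / (2 * pi) * inverse (sqrt (real n))) \<longlonglongrightarrow> 0 + C / (2 * pi) * 0"
    by (intro tendsto_intros lim_const_over_n tendsto_inverse_0_at_top
        filterlim_compose[OF sqrt_at_top filterlim_real_sequentially])
  then have "\<forall>\<^sub>F n in sequentially. K / (2 * pi) / real n + C / (2 * pi) * inverse (sqrt (real n)) < e"
    using e by (intro order_tendstoD(2)) auto
  then show ?thesis
    using C eventually_gt_at_top[of 0]
  proof eventually_elim
    case (elim n)
    have s: "sqrt (real n) * sqrt (real n) = real n" "sqrt (real n) > 0" using elim by auto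
    have "(K + \<bar>lam n - (2 * pi * real n)\<^sup>2\<bar>) / (2 * pi * real n) \<le> (K + C * sqrt (real n)) / (2 * pi * real n)"
      using elim by (intro divide_right_mono) (auto simp: powr_half_sqrt)
    also have "\<dots> = K / (2 * pi) / real n + C / (2 * pi) * (sqrt (real n) / real n)"
      using elim by (simp add: field_simps)
    also have "sqrt (real n) / real n = inverse (sqrt (real n))"
      using s by (simp add: field_simps)
    finally show ?case using elim by simp
  qed
qed

text \<open>In \<open>remainder_le\<close> the bound is \<open>1 / w\<close> times a quantity that tends to zero: \<open>r\<close> becomes small by the uniform
  Riemann-Lebesgue lemma for \<open>q\<close> and for \<open>q\<close> times its primitive, and the other summand has the factor \<open>1 / w\<close>.\<close>

lemma remainder_smallo:
  assumes sol: "\<forall>\<^sub>F n in sequentially. normalized_periodic_solution q (lam n) (y n) (z n) n"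
    and lam: "(\<lambda>n. lam n - (2 * pi * real n)\<^sup>2) \<in> O(\<lambda>n. real n powr (1/2))"
    and q: "q absolutely_integrable_on {0..1}"
    and \<alpha>: "\<forall>\<^sub>F n in sequentially. (\<alpha> n :: complex) =
        of_real (lam n - (2 * pi * real n)\<^sup>2) * normalized_periodic_solution.u (y n) n
        - normalized_periodic_solution.\<kappa> q n * cnj (normalized_periodic_solution.u (y n) n)"
  shows "(\<lambda>n. cmod (\<alpha> n)) \<in> o(\<lambda>n. 1 / real n)"
proof (rule landau_o.smallI)
  fix b :: real assume b: "b > 0"
  define M where "M = integral {0..1} (\<lambda>t. \<bar>q t\<bar>)"
  have M0: "M \<ge> 0"
    unfolding M_def using q by (intro integral_nonneg) (auto simp: absolutely_integrable_on_def)
  \<comment> \<open>Each of the two summands of \<open>remainder_le\<close> gets half of \<open>2\<pi>b\<close>, the value that turns \<open>1 / w\<close> into \<open>b / n\<close>.\<close>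
  define r where "r = b * pi / (1 + 15 * M)"
  have r0: "r > 0" using b M0 by (auto simp: r_def intro!: divide_pos_pos)
  have cq: "continuous_on {0..1} (\<lambda>x. integral {0..x} q)"
    using q by (intro indefinite_integral_continuous_1) (simp add: absolutely_integrable_on_def)
  have qQ: "(\<lambda>t. q t * integral {0..t} q) absolutely_integrable_on {0..1}"
    using absolutely_integrable_scaleR_continuous[OF q cq] by simp
  obtain W1 where W1: "\<And>w x. \<bar>w\<bar> \<ge> W1 \<Longrightarrow> x \<in> {0..1} \<Longrightarrow>
      norm (integral {0..x} (\<lambda>t. q t *\<^sub>R cis (w * t))) < r"
    using Riemann_Lebesgue_uniform[OF q r0] by blast
  obtain W2 where W2: "\<And>w x. \<bar>w\<bar> \<ge> W2 \<Longrightarrow> x \<in> {0..1} \<Longrightarrow>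
      norm (integral {0..x} (\<lambda>t. (q t * integral {0..t} q) *\<^sub>R cis (w * t))) < r"
    using Riemann_Lebesgue_uniform[OF qQ r0] by blast
  have ex: "\<forall>\<^sub>F n in sequentially. X \<le> real n" for X
    using filterlim_real_sequentially by (auto simp: filterlim_at_top)
  show "\<forall>\<^sub>F n in sequentially. norm (cmod (\<alpha> n)) \<le> b * norm (1 / real n)"
    using sol \<alpha> eventually_\<epsilon>_le[OF lam, of "1/50" M, simplified]
      ex[of W1] ex[of W2] ex[of "50 * M ^ 3 / (b * pi)"] ex[of 1]
  proof eventually_elim
    case (elim n)
    interpret normalized_periodic_solution q "lam n" "y n" "z n" n by fact
    have KK: "K = M" by (simp add: K_def M_def)
    have "\<epsilon> \<le> 1 / 50"
      using elim(3) by (simp add: \<epsilon>_def KK d_def w_def)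
    have wn: "2 * w \<ge> real n" "w \<ge> real n" unfolding w_def using pi_gt3 elim(7)
      mult_right_mono[of 1 "2 * pi" "real n"] by auto
    have "cmod (d *\<^sub>R u - \<kappa> * cnj u) \<le> ((1 + 15 * M) * r + 50 * M ^ 3 / w) / w"
      unfolding KK[symmetric]
    proof (rule remainder_le)
      show "\<epsilon> \<le> 1 / 50" by fact
      show "cmod (integral {0..x} (\<lambda>t. q t *\<^sub>R cis (- (2 * w * t)))) \<le> r" if "x \<in> {0..1}" for x
        using W1[of "- (2 * w)" x] that elim(4) wn w_pos by simp
      show "cmod (integral {0..1} (\<lambda>t. (q t * integral {0..t} q) *\<^sub>R cis (- (2 * w * t)))) \<le> r"
        using W2[of "- (2 * w)" 1] elim(5) wn w_pos by simp
    qed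
    also have "\<dots> \<le> (b * pi + b * pi) / w"
    proof (intro divide_right_mono add_mono)
      show "(1 + 15 * M) * r \<le> b * pi" using M0 by (simp add: r_def)
      have "50 * M ^ 3 / (b * pi) \<le> w" using elim(6) wn by linarith
      then show "50 * M ^ 3 / w \<le> b * pi"
        using b w_pos by (simp add: field_simps)
    qed (use w_pos in auto)
    also have "\<dots> = b * norm (1 / real n)"
      using n_pos by (simp add: w_def)
    finally show ?case
      using elim(2) by (simp add: d_def w_def scaleR_conv_of_real)
  qed
qed

text \<open>Neighbouring squares \<open>(2\<pi>n)\<^sup>2\<close> are further apart than the deviations \<open>O(n\<^sup>1\<^sup>/\<^sup>2)\<close>.  The indices below the range of
  this estimate give finitely many values, which a large eigenvalue exceeds.\<close>

lemma eigenvalues_eventually_separated: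
  fixes lam :: "nat \<Rightarrow> nat \<Rightarrow> real"
  assumes lam: "\<And>j. j \<in> {1,2} \<Longrightarrow> (\<lambda>n. lam n j - (2 * pi * real n)\<^sup>2) \<in> O(\<lambda>n. real n powr (1/2))"
  shows "\<forall>\<^sub>F n in sequentially. \<forall>m. \<forall>i\<in>{1,2}. \<forall>j\<in>{1,2}. lam m i = lam n j \<longrightarrow> m = n"
proof -
  have "\<forall>\<^sub>F n in sequentially. \<bar>lam n j - (2 * pi * real n)\<^sup>2\<bar> \<le> real n" if j: "j \<in> {1,2}" for j
    using eventually_\<epsilon>_le[OF lam[OF j], where e="1 / (2 * pi)" and K=0, simplified] eventually_gt_at_top[of 0]
  proof eventually_elim
    case (elim n) 
    then show ?case by (simp add: field_simps)
  qed
  from this[of 1] this[of 2]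
  have "\<forall>\<^sub>F n in sequentially. \<forall>j\<in>{1,2}. \<bar>lam n j - (2 * pi * real n)\<^sup>2\<bar> \<le> real n"
    by (auto elim: eventually_elim2)
  then obtain N where N: "\<And>n j. n \<ge> N \<Longrightarrow> j \<in> {1,2} \<Longrightarrow> \<bar>lam n j - (2 * pi * real n)\<^sup>2\<bar> \<le> real n"
    unfolding eventually_sequentially by blast
  obtain B where B: "\<And>m i. m < N \<Longrightarrow> i \<in> {1,2} \<Longrightarrow> lam m i \<le> B"
  proof -
    have "finite ((\<lambda>(m, i). lam m i) ` ({..<N} \<times> {1,2}))" by simp
    then obtain B where "\<forall>x \<in> (\<lambda>(m, i). lam m i) ` ({..<N} \<times> {1,2}). x \<le> B"
      using bdd_above_finite bdd_above_def by metis
    then show ?thesis by (intro that[of B]) auto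
  qed
  have "\<forall>\<^sub>F n in sequentially. B + 1 \<le> real n"
    using filterlim_real_sequentially by (auto simp: filterlim_at_top)
  then show ?thesis
    using eventually_ge_at_top[of N] eventually_gt_at_top[of 0]
  proof eventually_elim
    case (elim n)
    have sq: "(2 * pi * real k)\<^sup>2 = 4 * pi\<^sup>2 * (real k)\<^sup>2" for k by (simp add: power_mult_distrib)
    have pi9: "pi\<^sup>2 \<ge> 1" using pi_gt3 by (simp add: one_le_power)
    show ?case
    proof (intro allI ballI impI)
      fix m i j assume i: "i \<in> {1, 2::nat}" and j: "j \<in> {1, 2::nat}" and eq: "lam m i = lam n j"
      show "m = n"
      proof (cases "m < N")
        case True
        have "1 * (real n * 1) \<le> pi\<^sup>2 * (real n * real n)"
          using pi9 elim by (intro mult_mono) auto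
        then have "(2 * pi * real n)\<^sup>2 \<ge> 4 * real n" unfolding sq by (simp add: power2_eq_square)
        then have "lam n j > B" using N[OF elim(2) j] elim by linarith
        then show ?thesis using B[OF True i] eq by simp
      next
        case False
        show ?thesis
        proof (rule ccontr)
          assume "m \<noteq> n"
          then have "1 \<le> \<bar>real m - real n\<bar>" by linarith
          then have "1 * (1 * (real m + real n)) \<le> pi\<^sup>2 * (\<bar>real m - real n\<bar> * (real m + real n))"
            using pi9 by (intro mult_mono) auto
          moreover have "\<bar>(2 * pi * real m)\<^sup>2 - (2 * pi * real n)\<^sup>2\<bar> = 4 * (pi\<^sup>2 * (\<bar>real m - real n\<bar> * (real m + real n)))"
          proof -
            have "(2 * pi * real m)\<^sup>2 - (2 * pi * real n)\<^sup>2 = 4 * (pi\<^sup>2 * ((real m - real n) * (real m + real n)))"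
              unfolding sq by (simp add: algebra_simps power2_eq_square)
            then show ?thesis by (simp add: abs_mult)
          qed
          ultimately have "4 * (real m + real n) \<le> \<bar>(2 * pi * real m)\<^sup>2 - (2 * pi * real n)\<^sup>2\<bar>"
            by simp
          moreover have "\<bar>lam n j - (2 * pi * real m)\<^sup>2\<bar> \<le> real m"
            using N[of m i] False i eq by simp
          ultimately show False
            using N[OF elim(2) j] elim(3) by (simp only: distrib_left)
        qed
      qed
    qed
  qed
qed

theorem theorem2:
  fixes q :: "real \<Rightarrow> real"
    and N0 :: nat
    and lam :: "nat \<Rightarrow> nat \<Rightarrow> real"
    and \<Psi> :: "nat \<Rightarrow> nat \<Rightarrow> real \<Rightarrow> real"
  assumes "\<And>x. q (x + 1) = q x"
    and "q absolutely_integrable_on {0..1}"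
    and "(LINT x:{0..1}|lebesgue. q x) = 0"
    and "L0_eigenvalue_sequences q N0 lam"
    and "L0_normalized_eigenfunctions q N0 lam \<Psi>"
    and "\<forall>\<^sub>F n in sequentially.
           cmod (fourier01 (\<lambda>x. of_real (q x)) (2 * int n))
             \<ge> 2 * (cmod (alpha_rem q lam \<Psi> n 1) + cmod (alpha_rem q lam \<Psi> n 2))"
  shows "(\<exists>N\<ge>N0. \<forall>n\<ge>N. fourier01 (\<lambda>x. of_real (q x)) (2 * int n) \<noteq> 0 \<longrightarrow>
            (\<forall>j\<in>{1,2}. L0_simple_eigenvalue q (of_real (lam n j)))) \<and>
         (\<forall>j\<in>{1,2}.
           (\<lambda>n. lam n j - ((2 * pi * real n)\<^sup>2
                  + (-1) ^ j * cmod (fourier01 (\<lambda>x. of_real (q x)) (2 * int n))))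
             \<in> o(\<lambda>n. 1 / real n))"
proof -
  note q = assms(2)
  define \<kappa> where fourier_q: "\<kappa> n = fourier01 (\<lambda>x. of_real (q x)) (2 * int n)" for n
  define \<alpha> where "\<alpha> n j = alpha_rem q lam \<Psi> n j" for n j
  define \<delta> where "\<delta> n j = lam n j - (2 * pi * real n)\<^sup>2" for n j
  define K where "K = integral {0..1} (\<lambda>t. \<bar>q t\<bar>)"
  have lam_O: "(\<lambda>n. lam n j - (2 * pi * real n)\<^sup>2) \<in> O(\<lambda>n. real n powr (1/2))" if "j \<in> {1,2}" for j
    using assms(4) that unfolding L0_eigenvalue_sequences_def by blast
  have lam_le: "lam n 1 \<le> lam n 2" if "n \<ge> N0" for n
    using assms(4) that unfolding L0_eigenvalue_sequences_def by blast
  obtain R where R: "\<And>n j. n \<ge> N0 \<Longrightarrow> j \<in> {1,2} \<Longrightarrow> lam n j > R"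
    and mult: "\<And>\<mu>. \<mu> > R \<Longrightarrow> card {(n, j). n \<ge> N0 \<and> j \<in> {1,2} \<and> lam n j = \<mu>} = L0_mult q (of_real \<mu>)"
    using assms(4) unfolding L0_eigenvalue_sequences_def by blast
  have eig: "L0_eigenfunction q (of_real (lam n j)) (\<lambda>x. of_real (\<Psi> n j x))"
    and norm: "norm01 (\<lambda>x. of_real (\<Psi> n j x)) = 1" if "n \<ge> N0" "j \<in> {1,2}" for n j
    using assms(5) that unfolding L0_normalized_eigenfunctions_def by blast+
  have "\<forall>n j. \<exists>z. n \<ge> N0 \<longrightarrow> j \<in> {1,2} \<longrightarrow> periodic_solution q (lam n j) (\<Psi> n j) z"
    using eigenfunction_imp_periodic_solution[OF q eig] by blast
  then obtain z where z: "\<And>n j. n \<ge> N0 \<Longrightarrow> j \<in> {1,2} \<Longrightarrow> periodic_solution q (lam n j) (\<Psi> n j) (z n j)"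
    by metis
  have q_mean: "integral {0..1} q = 0"
    using assms(3) set_lebesgue_integral_eq_integral(2)[OF q] by simp
  have sol: "normalized_periodic_solution q (lam n j) (\<Psi> n j) (z n j) n"
    if "n \<ge> N0" "n > 0" "j \<in> {1,2}" for n j
  proof -
    interpret periodic_solution q "lam n j" "\<Psi> n j" "z n j" using z that by blast
    show ?thesis
      using norm[OF that(1,3)] norm01_of_real[OF y_cont] q_mean that
      by unfold_locales (auto simp: real_sqrt_eq_1_iff)
  qed
  have \<kappa>_eq: "\<kappa> n = normalized_periodic_solution.\<kappa> q n" if "n \<ge> N0" "n > 0" for n
  proof -
    interpret normalized_periodic_solution q "lam n 1" "\<Psi> n 1" "z n 1" n using sol that by blast
    show ?thesis
      unfolding fourier_q \<kappa>_def
      by (simp add: fourier01_def ip01_expi2pi[OF q] w_def mult_ac)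
  qed
  have \<alpha>_eq: "\<alpha> n j = of_real (\<delta> n j) * normalized_periodic_solution.u (\<Psi> n j) n
        - \<kappa> n * cnj (normalized_periodic_solution.u (\<Psi> n j) n)"
    if "n \<ge> N0" "n > 0" "j \<in> {1,2}" for n j
  proof -
    interpret normalized_periodic_solution q "lam n j" "\<Psi> n j" "z n j" n using sol that by blast
    have "ip01 (\<lambda>x. of_real (\<Psi> n j x)) (expi2pi (int n)) = u"
      unfolding u_def w_def
      by (simp add: ip01_expi2pi[OF absolutely_integrable_continuous_real[OF y_cont]])
    then show ?thesis
      by (simp add: \<alpha>_def alpha_rem_def Let_def fourier_q \<delta>_def)
  qed
  have large: "\<forall>\<^sub>F n in sequentially. n \<ge> N0 \<and> n > 0"
    by (intro eventually_conj eventually_ge_at_top eventually_gt_at_top)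
  have \<alpha>_small: "(\<lambda>n. cmod (\<alpha> n j)) \<in> o(\<lambda>n. 1 / real n)" if j: "j \<in> {1,2}" for j
  proof (rule remainder_smallo[OF _ lam_O[OF j] q])
    show "\<forall>\<^sub>F n in sequentially. normalized_periodic_solution q (lam n j) (\<Psi> n j) (z n j) n"
      using large by eventually_elim (use sol j in blast)
    show "\<forall>\<^sub>F n in sequentially. \<alpha> n j =
        of_real (lam n j - (2 * pi * real n)\<^sup>2) * normalized_periodic_solution.u (\<Psi> n j) n
        - normalized_periodic_solution.\<kappa> q n * cnj (normalized_periodic_solution.u (\<Psi> n j) n)"
      using large by eventually_elim (use \<alpha>_eq \<kappa>_eq j in \<open>simp add: \<delta>_def\<close>)
  qed
  \<comment> \<open>The bound 1/1400 makes the error terms \<open>14 \<epsilon>\<close> and \<open>8 \<epsilon>\<close> of the coefficients at most 1/100.\<close>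
  have \<epsilon>_small: "\<forall>\<^sub>F n in sequentially. (K + \<bar>\<delta> n j\<bar>) / (2 * pi * real n) \<le> 1 / 1400" if "j \<in> {1,2}" for j
    unfolding \<delta>_def by (rule eventually_\<epsilon>_le[OF lam_O[OF that]]) simp
  have \<epsilon>_small1: "\<forall>\<^sub>F n in sequentially. (K + \<bar>\<delta> n 1\<bar>) / (2 * pi * real n) \<le> 1 / 1400"
    and \<epsilon>_small2: "\<forall>\<^sub>F n in sequentially. (K + \<bar>\<delta> n 2\<bar>) / (2 * pi * real n) \<le> 1 / 1400"
    by (rule \<epsilon>_small; simp)+
  have key: "\<forall>\<^sub>F n in sequentially.
      (\<bar>\<delta> n 1 + cmod (\<kappa> n)\<bar> \<le> 14 * (cmod (\<alpha> n 1) + cmod (\<alpha> n 2)) \<and>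
       \<bar>\<delta> n 2 - cmod (\<kappa> n)\<bar> \<le> 14 * (cmod (\<alpha> n 1) + cmod (\<alpha> n 2))) \<and>
      (\<kappa> n \<noteq> 0 \<longrightarrow> 2 * (cmod (\<alpha> n 1) + cmod (\<alpha> n 2)) \<le> cmod (\<kappa> n) \<longrightarrow> \<delta> n 1 < \<delta> n 2)"
    using large \<epsilon>_small1 \<epsilon>_small2
  proof eventually_elim
    case (elim n)
    then have n: "n \<ge> N0" "n > 0" by auto
    interpret A: normalized_periodic_solution q "lam n 1" "\<Psi> n 1" "z n 1" n using sol n by blast
    interpret B: normalized_periodic_solution q "lam n 2" "\<Psi> n 2" "z n 2" n using sol n by blast
    have "A.\<epsilon> = (K + \<bar>\<delta> n 1\<bar>) / (2 * pi * real n)" "B.\<epsilon> = (K + \<bar>\<delta> n 2\<bar>) / (2 * pi * real n)"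
      by (simp_all only: A.\<epsilon>_def B.\<epsilon>_def A.d_def B.d_def A.w_def A.K_def K_def \<delta>_def)
    with elim(2,3) have eA: "A.\<epsilon> \<le> 1 / 1400" and eB: "B.\<epsilon> \<le> 1 / 1400" by simp_all
    then have eA': "A.\<epsilon> \<le> 1 / 50" and eB': "B.\<epsilon> \<le> 1 / 50" by linarith+
    have orth: "integral {0..1} (\<lambda>t. \<Psi> n 1 t * \<Psi> n 2 t) = 0"
    proof (cases "lam n 1 = lam n 2")
      case True
      then have "ip01 (\<lambda>x. of_real (\<Psi> n 1 x)) (\<lambda>x. of_real (\<Psi> n 2 x)) = 0"
        using assms(5) n unfolding L0_normalized_eigenfunctions_def by blast
      then show ?thesis using ip01_of_real[OF A.y_cont B.y_cont] by simp
    next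
      case False
      then show ?thesis
        using periodic_solutions_orthogonal[OF A.periodic_solution_axioms B.periodic_solution_axioms] by simp
    qed
    have le: "\<delta> n 1 \<le> \<delta> n 2" using lam_le n by (simp add: \<delta>_def)
    have e1: "of_real (\<delta> n 1) * A.u = \<kappa> n * cnj A.u + \<alpha> n 1" using \<alpha>_eq[of n 1] n by simp
    have e2: "of_real (\<delta> n 2) * B.u = \<kappa> n * cnj B.u + \<alpha> n 2" using \<alpha>_eq[of n 2] n by simp
    have nA: "\<bar>1 - 2 * (cmod A.u)\<^sup>2\<bar> \<le> 1 / 100" using A.norm_u_sq[OF eA'] eA by linarith
    have nB: "\<bar>1 - 2 * (cmod B.u)\<^sup>2\<bar> \<le> 1 / 100" using B.norm_u_sq[OF eB'] eB by linarith
    have "\<bar>Re (A.u * cnj B.u)\<bar> \<le> 8 * (1 / 1400)"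
      by (rule orthogonal_pair_coefficients[OF A.normalized_periodic_solution_axioms
            B.normalized_periodic_solution_axioms orth eA eB]) simp
    then have o: "\<bar>Re (A.u * cnj B.u)\<bar> \<le> 1 / 100" by linarith
    show ?case
      using splitting_estimates[OF le e1 e2 nA nB o] splitting_strict[OF le e1 e2 nA nB o] by blast
  qed
  have asym: "(\<lambda>n. lam n j - ((2 * pi * real n)\<^sup>2 + (-1) ^ j * cmod (\<kappa> n))) \<in> o(\<lambda>n. 1 / real n)"
    if j: "j \<in> {1,2}" for j
  proof (rule landau_o.big_small_trans)
    show "(\<lambda>n. cmod (\<alpha> n 1) + cmod (\<alpha> n 2)) \<in> o(\<lambda>n. 1 / real n)"
      by (intro sum_in_smallo \<alpha>_small) auto
    show "(\<lambda>n. lam n j - ((2 * pi * real n)\<^sup>2 + (-1) ^ j * cmod (\<kappa> n))) \<in> O(\<lambda>n. cmod (\<alpha> n 1) + cmod (\<alpha> n 2))"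
    proof (rule bigoI)
      show "\<forall>\<^sub>F n in sequentially. norm (lam n j - ((2 * pi * real n)\<^sup>2 + (-1) ^ j * cmod (\<kappa> n)))
          \<le> 14 * norm (cmod (\<alpha> n 1) + cmod (\<alpha> n 2))"
        using key
      proof eventually_elim
        case (elim n)
        have "norm (lam n j - ((2 * pi * real n)\<^sup>2 + (-1) ^ j * cmod (\<kappa> n))) \<le> 14 * (cmod (\<alpha> n 1) + cmod (\<alpha> n 2))"
        proof (cases "j = 1")
          case True
          then have "lam n j - ((2 * pi * real n)\<^sup>2 + (-1) ^ j * cmod (\<kappa> n)) = \<delta> n 1 + cmod (\<kappa> n)"
            by (simp add: \<delta>_def)
          then show ?thesis using elim by simp
        next
          case False
          with j have "lam n j - ((2 * pi * real n)\<^sup>2 + (-1) ^ j * cmod (\<kappa> n)) = \<delta> n 2 - cmod (\<kappa> n)"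
            by (simp add: \<delta>_def)
          then show ?thesis using elim by simp
        qed
        then show ?case by simp
      qed
    qed
  qed
  have separated: "\<forall>\<^sub>F n in sequentially. \<forall>m. \<forall>i\<in>{1,2}. \<forall>j\<in>{1,2}. lam m i = lam n j \<longrightarrow> m = n"
    by (rule eigenvalues_eventually_separated) (rule lam_O)
  have "\<forall>\<^sub>F n in sequentially. n \<ge> N0 \<and> (\<kappa> n \<noteq> 0 \<longrightarrow> (\<forall>j\<in>{1,2}. L0_simple_eigenvalue q (of_real (lam n j))))"
    using large key assms(6)[folded \<alpha>_def fourier_q] separated
  proof eventually_elim
    case (elim n)
    then have n: "n \<ge> N0" "n > 0" by auto
    have "L0_simple_eigenvalue q (of_real (lam n j))" if \<kappa>: "\<kappa> n \<noteq> 0" and j: "j \<in> {1,2}" for j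
    proof -
      have "\<delta> n 1 < \<delta> n 2" using elim(2,3) \<kappa> by blast
      then have ne: "lam n 1 < lam n 2" by (simp add: \<delta>_def)
      have "{(m, i). m \<ge> N0 \<and> i \<in> {1,2} \<and> lam m i = lam n j} = {(n, j)}"
        using elim(4) j ne n by fastforce
      then show ?thesis
        using mult[OF R[OF n(1) j]] by (simp add: L0_simple_eigenvalue_def)
    qed
    then show ?case using n by blast
  qed
  then obtain N where N: "\<And>n. n \<ge> N \<Longrightarrow> n \<ge> N0 \<and> (\<kappa> n \<noteq> 0 \<longrightarrow> (\<forall>j\<in>{1,2}. L0_simple_eigenvalue q (of_real (lam n j))))"
    unfolding eventually_sequentially by blast
  have "N \<ge> N0" using N[of N] by simp
  moreover have "\<forall>n\<ge>N. \<kappa> n \<noteq> 0 \<longrightarrow> (\<forall>j\<in>{1,2}. L0_simple_eigenvalue q (of_real (lam n j)))"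
    using N by blast
  ultimately show ?thesis
    using asym unfolding fourier_q by blast
qed

end
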